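(* Let $\mathcal{Q}$ be a thin forest poset (with its standard labeling). Then the map $\phi:\mathsf{As}(\mathcal{Q}^\perp)\to\mathsf{As}(\mathcal{Q})^!$ defined for every $b\in\mathcal{Q}^\perp$ by $$\phi(\star_b):=\bar{\mathtt{A}}_b:=\sum_{\substack{a\in\mathcal{Q}^\perp\\ a\preccurlyeq_{\mathcal{Q}^\perp} b}}\ \sum_{\substack{c\in\mathcal{Q}\\ a\preccurlyeq_\mathcal{Q} c}}\bar\star_c$$ extends in a unique way to an isomorphism of operads.
   Context: Operads are nonsymmetric over a field $\mathbb{K}$ of characteristic zero. For a finite poset $\mathcal{Q}$ and comparable $a,b$, $a\uparrow_\mathcal{Q} b:=\min(a,b)$. $\mathsf{As}(\mathcal{Q})$ is the operad with presentation $(\mathfrak{G},\mathfrak{R})$ where $\mathfrak{G}=\{\star_a:a\in\mathcal{Q}\}$ are binary generators and $\mathfrak{R}$ is spanned by $\star_a\circ_1\star_b-\star_{a\uparrow b}\circ_2\star_{a\uparrow b}$ and $\star_{a\uparrow b}\circ_1\star_{a\uparrow b}-\star_a\circ_2\star_b$ for all comparable $a,b$ (including $a=b$). Koszul dual: for a binary quadratic operad with presentation $(\mathfrak{G},\mathfrak{R})$, $\mathfrak{G}$ finite, its Koszul dual has presentation $(\bar{\mathfrak{G}},\mathfrak{R}^\perp)$, where $\bar\star_a$ denotes the generator corresponding to $\star_a$ and $\mathfrak{R}^\perp$ is the annihilator of $\mathfrak{R}$ in the arity-$3$ part of the free operad for the bilinear form with $\langle x\circ_i y,x'\circ_{i'}y'\rangle=1$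 if $x=x',y=y',i=i'=1$, $=-1$ if $x=x',y=y',i=i'=2$, and $0$ otherwise. A forest poset is a poset with no element lying strictly above two incomparable elements; its Hasse diagram is a forest of rooted trees with minimal elements as roots. A thin forest poset is a forest poset containing no four elements $a\prec b$, $c\prec d$ with each of $a,b$ incomparable to each of $c,d$; equivalently, adding a new common root to the Hasse diagram yields a rooted tree in which every node has at most one child whose subtree has two or more nodes. The standard labeling of a thin forest poset labels its elements $1,\dots,\#\mathcal{Q}$ in the order of a depth-first (preorder) traversal of this forest in which, among siblings, the one with the largest subtree is visited last; elements are identified with their labels. The dual $\mathcal{Q}^\perp$ is the poset on the same set $\{1,\dots,\#\mathcal{Q}\}$ with $a\preccurlyeq_{\mathcal{Q}^\perp}b$ iff $a=b$, or $a,b$ are incomparable in $\mathcal{Q}$ and $a<b$ as integers; it is again a thin forest poset. *)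

theory Defs
  imports Complex_Main "HOL-Library.Tree" "HOL-Library.Poly_Mapping"
begin

section \<open>Nonsymmetric operads\<close>

text \<open>The structure of a nonsymmetric operad in the category of vector spaces over \<open>'k\<close>.
  The component of arity \<open>n\<close> is the set \<open>opd_space P n\<close> with the vector space operations
  \<open>opd_add P n\<close>, \<open>opd_zero P n\<close>, \<open>opd_scale P n\<close>; for \<open>x\<close> of arity \<open>m\<close> and \<open>y\<close> of arity \<open>n\<close>,
  the partial composition of \<open>x\<close> and \<open>y\<close> at the input \<open>i\<close>, with \<open>1 \<le> i \<le> m\<close>,
  is \<open>opd_comp P m i n x y\<close>, of arity \<open>m + n - 1\<close>.\<close>

record ('k, 'x) ns_operad =
  opd_space :: "nat \<Rightarrow> 'x set"
  opd_add   :: "nat \<Rightarrow> 'x \<Rightarrow> 'x \<Rightarrow> 'x"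
  opd_zero  :: "nat \<Rightarrow> 'x"
  opd_scale :: "nat \<Rightarrow> 'k \<Rightarrow> 'x \<Rightarrow> 'x"
  opd_unit  :: "'x"
  opd_comp  :: "nat \<Rightarrow> nat \<Rightarrow> nat \<Rightarrow> 'x \<Rightarrow> 'x \<Rightarrow> 'x"

definition operad_hom ::
  "('k, 'x) ns_operad \<Rightarrow> ('k, 'y) ns_operad \<Rightarrow> (nat \<Rightarrow> 'x \<Rightarrow> 'y) \<Rightarrow> bool" where
  "operad_hom P Q \<phi> \<longleftrightarrow>
     (\<forall>n. \<forall>x \<in> opd_space P n. \<phi> n x \<in> opd_space Q n) \<and>
     (\<forall>n. \<forall>x \<in> opd_space P n. \<forall>y \<in> opd_space P n.
        \<phi> n (opd_add P n x y) = opd_add Q n (\<phi> n x) (\<phi> n y)) \<and>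
     (\<forall>n c. \<forall>x \<in> opd_space P n. \<phi> n (opd_scale P n c x) = opd_scale Q n c (\<phi> n x)) \<and>
     \<phi> 1 (opd_unit P) = opd_unit Q \<and>
     (\<forall>m n i. 1 \<le> i \<and> i \<le> m \<longrightarrow>
        (\<forall>x \<in> opd_space P m. \<forall>y \<in> opd_space P n.
           \<phi> (m + n - 1) (opd_comp P m i n x y) = opd_comp Q m i n (\<phi> m x) (\<phi> n y)))"

definition operad_iso ::
  "('k, 'x) ns_operad \<Rightarrow> ('k, 'y) ns_operad \<Rightarrow> (nat \<Rightarrow> 'x \<Rightarrow> 'y) \<Rightarrow> bool" where
  "operad_iso P Q \<phi> \<longleftrightarrow>
     operad_hom P Q \<phi> \<and> (\<forall>n. bij_betw (\<phi> n) (opd_space P n) (opd_space Q n))"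

definition operad_ideal :: "('k, 'x) ns_operad \<Rightarrow> (nat \<Rightarrow> 'x set) \<Rightarrow> bool" where
  "operad_ideal P I \<longleftrightarrow>
     (\<forall>n. I n \<subseteq> opd_space P n \<and> opd_zero P n \<in> I n) \<and>
     (\<forall>n. \<forall>x \<in> I n. \<forall>y \<in> I n. opd_add P n x y \<in> I n) \<and>
     (\<forall>n c. \<forall>x \<in> I n. opd_scale P n c x \<in> I n) \<and>
     (\<forall>m n i. 1 \<le> i \<and> i \<le> m \<longrightarrow>
        (\<forall>x \<in> I m. \<forall>y \<in> opd_space P n. opd_comp P m i n x y \<in> I (m + n - 1)) \<and>
        (\<forall>x \<in> opd_space P m. \<forall>y \<in> I n. opd_comp P m i n x y \<in> I (m + n - 1)))"

definition generated_ideal :: "('k, 'x) ns_operad \<Rightarrow> (nat \<Rightarrow> 'x set) \<Rightarrow> nat \<Rightarrow> 'x set" where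
  "generated_ideal P R n = \<Inter> {I n | I. operad_ideal P I \<and> (\<forall>m. R m \<subseteq> I m)}"

definition opd_coset :: "('k, 'x) ns_operad \<Rightarrow> (nat \<Rightarrow> 'x set) \<Rightarrow> nat \<Rightarrow> 'x \<Rightarrow> 'x set" where
  "opd_coset P I n x = opd_add P n x ` I n"

text \<open>When \<open>I\<close> is an ideal, each of the unions below ranges over one and the same coset,
  namely that of the result of the operation on arbitrary representatives.\<close>

definition quotient_operad ::
  "('k, 'x) ns_operad \<Rightarrow> (nat \<Rightarrow> 'x set) \<Rightarrow> ('k, 'x set) ns_operad" where
  "quotient_operad P I = \<lparr>
     opd_space = (\<lambda>n. opd_coset P I n ` opd_space P n),
     opd_add = (\<lambda>n X Y. \<Union>x\<in>X. \<Union>y\<in>Y. opd_coset P I n (opd_add P n x y)),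
     opd_zero = (\<lambda>n. opd_coset P I n (opd_zero P n)),
     opd_scale = (\<lambda>n c X. \<Union>x\<in>X. opd_coset P I n (opd_scale P n c x)),
     opd_unit = opd_coset P I 1 (opd_unit P),
     opd_comp = (\<lambda>m i n X Y. \<Union>x\<in>X. \<Union>y\<in>Y. opd_coset P I (m + n - 1) (opd_comp P m i n x y)) \<rparr>"


section \<open>Free operads on binary generators\<close>

text \<open>A basis of the arity \<open>n\<close> component of the free operad on binary generators \<open>G\<close> consists of
  the binary trees with \<open>n\<close> leaves and internal nodes labelled by \<open>G\<close>; \<open>size1\<close> is the number
  of leaves.  Grafting replaces the \<open>i\<close>-th leaf, counted from the left starting with 1.\<close>

fun graft :: "nat \<Rightarrow> 'g tree \<Rightarrow> 'g tree \<Rightarrow> 'g tree" where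
  "graft i Leaf s = s"
| "graft i (Node l a r) s =
     (if i \<le> size1 l then Node (graft i l s) a r else Node l a (graft (i - size1 l) r s))"

definition corolla :: "'g \<Rightarrow> 'g tree" where
  "corolla a = Node Leaf a Leaf"

type_synonym ('g, 'k) tree_comb = "'g tree \<Rightarrow>\<^sub>0 'k"

definition tc_scale :: "'k::field \<Rightarrow> ('g, 'k) tree_comb \<Rightarrow> ('g, 'k) tree_comb" where
  "tc_scale c = Poly_Mapping.map ((*) c)"

lemma lookup_tc_scale: "Poly_Mapping.lookup (tc_scale c f) t = c * Poly_Mapping.lookup f t"
  by (simp add: tc_scale_def Poly_Mapping.map.rep_eq when_def)

lemma vector_space_tc_scale: "vector_space tc_scale"
  by unfold_locales
    (rule poly_mapping_eqI, simp add: lookup_tc_scale lookup_add algebra_simps)+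

definition free_operad :: "'g set \<Rightarrow> ('k::field, ('g, 'k) tree_comb) ns_operad" where
  "free_operad G = \<lparr>
     opd_space = (\<lambda>n. {f. \<forall>t \<in> Poly_Mapping.keys f. size1 t = n \<and> set_tree t \<subseteq> G}),
     opd_add = (\<lambda>n f g. f + g),
     opd_zero = (\<lambda>n. 0),
     opd_scale = (\<lambda>n. tc_scale),
     opd_unit = Poly_Mapping.single Leaf 1,
     opd_comp = (\<lambda>m i n f g.
       \<Sum>t\<in>Poly_Mapping.keys f. \<Sum>s\<in>Poly_Mapping.keys g.
         Poly_Mapping.single (graft i t s) (Poly_Mapping.lookup f t * Poly_Mapping.lookup g s)) \<rparr>"

definition gen :: "'g \<Rightarrow> ('g, 'k::field) tree_comb" where
  "gen a = Poly_Mapping.single (corolla a) 1"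

text \<open>The basis element \<open>x \<circ>\<^sub>i y\<close> (\<open>i = 1, 2\<close>) of the arity 3 component.\<close>

definition gen_comp :: "'g \<Rightarrow> nat \<Rightarrow> 'g \<Rightarrow> ('g, 'k::field) tree_comb" where
  "gen_comp x i y = Poly_Mapping.single (graft i (corolla x) (corolla y)) 1"

lemma gen_comp_eq: "gen_comp x i y = opd_comp (free_operad G) 2 i 2 (gen x) (gen y)"
  by (simp add: gen_comp_def gen_def free_operad_def)


section \<open>Binary quadratic presentations and Koszul duals\<close>

text \<open>A pair of a set of binary generators and a subspace \<open>R\<close> of the arity 3 component of the free
  operad on it.\<close>

type_synonym ('g, 'k) presentation = "'g set \<times> ('g, 'k) tree_comb set"

definition relation_ideal :: "('g, 'k::field) presentation \<Rightarrow> nat \<Rightarrow> ('g, 'k) tree_comb set" where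
  "relation_ideal p = generated_ideal (free_operad (fst p)) (\<lambda>n. if n = 3 then snd p else {})"

definition presented_operad ::
  "('g, 'k::field) presentation \<Rightarrow> ('k, ('g, 'k) tree_comb set) ns_operad" where
  "presented_operad p = quotient_operad (free_operad (fst p)) (relation_ideal p)"

text \<open>The image in the arity \<open>n\<close> component of the presented operad of an element of the free one.\<close>

definition pres_class ::
  "('g, 'k::field) presentation \<Rightarrow> nat \<Rightarrow> ('g, 'k) tree_comb \<Rightarrow> ('g, 'k) tree_comb set" where
  "pres_class p n f = opd_coset (free_operad (fst p)) (relation_ideal p) n f"

definition koszul_form_basis :: "'g tree \<Rightarrow> 'g tree \<Rightarrow> 'k::field" where
  "koszul_form_basis t t' =
     (if t = t' \<and> (\<exists>x y. t = graft 1 (corolla x) (corolla y)) then 1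
      else if t = t' \<and> (\<exists>x y. t = graft 2 (corolla x) (corolla y)) then - 1
      else 0)"

definition koszul_form :: "('g, 'k::field) tree_comb \<Rightarrow> ('g, 'k) tree_comb \<Rightarrow> 'k" where
  "koszul_form f g =
     (\<Sum>t\<in>Poly_Mapping.keys f. \<Sum>t'\<in>Poly_Mapping.keys g.
        Poly_Mapping.lookup f t * Poly_Mapping.lookup g t' * koszul_form_basis t t')"

text \<open>The generator of the Koszul dual corresponding to a generator carries the same label.\<close>

definition koszul_dual :: "('g, 'k::field) presentation \<Rightarrow> ('g, 'k) presentation" where
  "koszul_dual p =
     (fst p, {f \<in> opd_space (free_operad (fst p)) 3. \<forall>g \<in> snd p. koszul_form f g = 0})"


section \<open>Operads from posets\<close>

text \<open>A poset is given by its ground set and its (reflexive) order relation;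
  \<open>(a, b) \<in> r\<close> means that \<open>a\<close> is below \<open>b\<close>.\<close>

definition comparable :: "'a rel \<Rightarrow> 'a \<Rightarrow> 'a \<Rightarrow> bool" where
  "comparable r a b \<longleftrightarrow> (a, b) \<in> r \<or> (b, a) \<in> r"

text \<open>Used for comparable arguments only.\<close>

definition poset_min :: "'a rel \<Rightarrow> 'a \<Rightarrow> 'a \<Rightarrow> 'a" where
  "poset_min r a b = (if (a, b) \<in> r then a else b)"

definition As_relators :: "'a set \<Rightarrow> 'a rel \<Rightarrow> ('a, 'k::field) tree_comb set" where
  "As_relators A r =
     {gen_comp a 1 b - gen_comp (poset_min r a b) 2 (poset_min r a b) | a b.
        a \<in> A \<and> b \<in> A \<and> comparable r a b} \<union>
     {gen_comp (poset_min r a b) 1 (poset_min r a b) - gen_comp a 2 b | a b.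
        a \<in> A \<and> b \<in> A \<and> comparable r a b}"

definition As_presentation :: "'a set \<Rightarrow> 'a rel \<Rightarrow> ('a, 'k::field) presentation" where
  "As_presentation A r = (A, module.span tc_scale (As_relators A r))"


section \<open>Thin forest posets, standard labelings and duals\<close>

definition forest_poset :: "'a set \<Rightarrow> 'a rel \<Rightarrow> bool" where
  "forest_poset A r \<longleftrightarrow>
     finite A \<and> partial_order_on A r \<and>
     \<not> (\<exists>a b c. (a, c) \<in> r \<and> a \<noteq> c \<and> (b, c) \<in> r \<and> b \<noteq> c \<and> \<not> comparable r a b)"

definition thin_forest_poset :: "'a set \<Rightarrow> 'a rel \<Rightarrow> bool" where
  "thin_forest_poset A r \<longleftrightarrow>
     forest_poset A r \<and>
     \<not> (\<exists>a b c d. (a, b) \<in> r \<and> a \<noteq> b \<and> (c, d) \<in> r \<and> c \<noteq> d \<and>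
          \<not> comparable r a c \<and> \<not> comparable r a d \<and>
          \<not> comparable r b c \<and> \<not> comparable r b d)"

text \<open>Planar rooted trees; the order of the list of children is the order in which a depth-first
  traversal visits them.\<close>

datatype 'a rtree = RNode (root: 'a) (children: "'a rtree list")

primrec preorder :: "'a rtree \<Rightarrow> 'a list" where
  "preorder (RNode a ts) = a # concat (map preorder ts)"

primrec tree_edges :: "'a rtree \<Rightarrow> 'a rel" where
  "tree_edges (RNode a ts) = {(a, root t) | t. t \<in> set ts} \<union> \<Union> (set (map tree_edges ts))"

definition largest_last :: "'a rtree list \<Rightarrow> bool" where
  "largest_last ts \<longleftrightarrow>
     (ts \<noteq> [] \<longrightarrow> (\<forall>t \<in> set ts. length (preorder t) \<le> length (preorder (last ts))))"

fun tree_largest_last :: "'a rtree \<Rightarrow> bool" where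
  "tree_largest_last (RNode a ts) \<longleftrightarrow> largest_last ts \<and> (\<forall>t \<in> set ts. tree_largest_last t)"

definition covers :: "'a rel \<Rightarrow> 'a rel" where
  "covers r = {(a, b). (a, b) \<in> r \<and> a \<noteq> b \<and>
     \<not> (\<exists>c. (a, c) \<in> r \<and> (c, b) \<in> r \<and> c \<noteq> a \<and> c \<noteq> b)}"

text \<open>\<open>ts\<close> is the Hasse diagram of the poset, drawn as a list of planar rooted trees.\<close>

definition hasse_forest :: "'a set \<Rightarrow> 'a rel \<Rightarrow> 'a rtree list \<Rightarrow> bool" where
  "hasse_forest A r ts \<longleftrightarrow>
     distinct (concat (map preorder ts)) \<and>
     set (concat (map preorder ts)) = A \<and>
     \<Union> (set (map tree_edges ts)) = covers r"

text \<open>The roots count as siblings.  Siblings of equal size may be visited in any order, so that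
  a labeling is standard if it arises from one of the admissible traversals.\<close>

definition standard_labeling :: "'a set \<Rightarrow> 'a rel \<Rightarrow> ('a \<Rightarrow> nat) \<Rightarrow> bool" where
  "standard_labeling A r lab \<longleftrightarrow>
     (\<exists>ts. hasse_forest A r ts \<and> largest_last ts \<and> (\<forall>t \<in> set ts. tree_largest_last t) \<and>
           map lab (concat (map preorder ts)) = [1..<Suc (card A)])"

text \<open>The order of the dual, on the same ground set \<open>A\<close>; elements are compared as integers through
  their labels.\<close>

definition dual_order :: "'a set \<Rightarrow> 'a rel \<Rightarrow> ('a \<Rightarrow> nat) \<Rightarrow> 'a rel" where
  "dual_order A r lab =
     {(a, b). a \<in> A \<and> b \<in> A \<and> (a = b \<or> (\<not> comparable r a b \<and> lab a < lab b))}"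

text \<open>Representative, in the free operad on \<open>A\<close>, of the image of the generator \<open>b\<close>.\<close>

definition Abar :: "'a set \<Rightarrow> 'a rel \<Rightarrow> ('a \<Rightarrow> nat) \<Rightarrow> 'a \<Rightarrow> ('a, 'k::field) tree_comb" where
  "Abar A r lab b = (\<Sum>a | (a, b) \<in> dual_order A r lab. \<Sum>c | (a, c) \<in> r. gen c)"

end

theory Submission
  imports Defs
begin

text \<open>
  Write \<open>S a\<close> for the sum of the generators above \<open>a\<close> in \<open>Q\<close>, so that the image of the
  generator \<open>b\<close> is \<open>B b\<close>, the sum of the \<open>S a\<close> over the \<open>a\<close> below \<open>b\<close> in the dual order.
  Both changes of basis are unitriangular, so \<open>b \<mapsto> B b\<close> extends to an automorphism of the free
  operad, and it suffices that this automorphism maps the space of relations of the source onto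
  that of the target.

  As \<open>Q\<close> is a forest, all elements above \<open>a\<close> are incomparable to all elements above \<open>b\<close> when
  \<open>a\<close> and \<open>b\<close> are incomparable; hence the relations of the Koszul dual are spanned by the
  \<open>S a \<circ>\<^sub>i S b\<close> with \<open>a\<close>, \<open>b\<close> incomparable and the \<open>S m \<circ>\<^sub>1 S m - S m \<circ>\<^sub>2 S m\<close>.  Thinness and the
  standard labeling make the dual order a forest order too, so the elements below a given one in
  it are pairwise incomparable in \<open>Q\<close>.  Modulo these relations, for \<open>a\<close> below \<open>b\<close> in the dual
  order, \<open>B a \<circ>\<^sub>i B b\<close> is therefore the sum of \<open>S c \<circ>\<^sub>1 S c\<close> over the \<open>c\<close> below \<open>a\<close>, which does not
  depend on \<open>b\<close> or \<open>i\<close>; the converse inclusion is an induction along the dual order.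
\<close>

section \<open>Free operads and their morphisms\<close>

text \<open>Orthogonality to the relations constrains coefficients at comparable labels only: for
  comparable \<open>x\<close>, \<open>y\<close> with minimum \<open>m\<close>, the coefficient at
  \<open>x \<circ>\<^sub>1 y\<close> is some F(m) and the one at \<open>x \<circ>\<^sub>2 y\<close>
  is -F(m). An element is below both \<open>x\<close> and \<open>y\<close> iff it is below
  \<open>m\<close>, so Moebius inversion of F turns these coefficients into a combination of
  indicators of the pairs lying above a given element, which are the coefficients of a product of
  \<open>S\<close> with itself. This is the origin of \<open>S\<close>. The second summation makes
  products telescope: for \<open>a\<close> below \<open>b\<close> in the dual order,
  \<open>B b - B a\<close> only involves \<open>S d\<close> with \<open>d\<close> strictly above
  \<open>a\<close> there, hence incomparable in the poset to everything contributing to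
  \<open>B a\<close>. To obtain both inclusions from one notion, the relations of the source are
  stated for the \<open>B b\<close> modulo an arbitrary subspace: the annihilator is shown to be
  such a subspace, and every such subspace is shown to contain the annihilator. The operads are bare
  data whose quotients consist of cosets, so the descent of the automorphism and the uniqueness of
  the result need a separate elementary treatment.\<close>

definition tcomp :: "nat \<Rightarrow> ('g, 'k::field) tree_comb \<Rightarrow> ('g, 'k) tree_comb \<Rightarrow> ('g, 'k) tree_comb" where
  "tcomp i f g = (\<Sum>t\<in>Poly_Mapping.keys f. \<Sum>s\<in>Poly_Mapping.keys g.
     Poly_Mapping.single (graft i t s) (Poly_Mapping.lookup f t * Poly_Mapping.lookup g s))"

text \<open>The linear extension of \<open>k\<close> from trees. Each argument of
  \<open>tcomp\<close>, the lift of a map on generators and, through its \<open>Leaf\<close>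
  coefficient, the Koszul form are all rewritten as instances, so that linearity is proved
  once.\<close>

definition lin :: "('g tree \<Rightarrow> ('h, 'k::field) tree_comb) \<Rightarrow> ('g, 'k) tree_comb \<Rightarrow> ('h, 'k) tree_comb" where
  "lin k f = (\<Sum>t\<in>Poly_Mapping.keys f. tc_scale (Poly_Mapping.lookup f t) (k t))"

interpretation tc: vector_space "tc_scale :: 'k::field \<Rightarrow> ('g, 'k) tree_comb \<Rightarrow> ('g, 'k) tree_comb"
  by (rule vector_space_tc_scale)

lemma tc_scale_single [simp]: "tc_scale c (Poly_Mapping.single t d) = Poly_Mapping.single t (c * d)"
  by (rule poly_mapping_eqI) (simp add: lookup_tc_scale lookup_single when_def)

text \<open>The defining sum runs over the support of \<open>f\<close>, which changes under addition
  and scaling; over a common finite superset the summands can be combined, the extra ones being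
  zero.\<close>

lemma lin_superset:
  assumes "finite T" "Poly_Mapping.keys f \<subseteq> T"
  shows "lin k f = (\<Sum>t\<in>T. tc_scale (Poly_Mapping.lookup f t) (k t))"
  unfolding lin_def
  by (rule sum.mono_neutral_left) (use assms in \<open>auto simp: in_keys_iff\<close>)

lemma lin_add: "lin k (f + g) = lin k f + lin k g"
proof -
  let ?T = "Poly_Mapping.keys f \<union> Poly_Mapping.keys g"
  have "lin k (f + g) = (\<Sum>t\<in>?T. tc_scale (Poly_Mapping.lookup (f + g) t) (k t))"
    by (rule lin_superset) (use Poly_Mapping.keys_add[of f g] in auto)
  moreover have "lin k f = (\<Sum>t\<in>?T. tc_scale (Poly_Mapping.lookup f t) (k t))"
    by (rule lin_superset) auto
  moreover have "lin k g = (\<Sum>t\<in>?T. tc_scale (Poly_Mapping.lookup g t) (k t))"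
    by (rule lin_superset) auto
  ultimately show ?thesis
    by (simp add: lookup_add tc.scale_left_distrib sum.distrib)
qed

lemma lin_scale: "lin k (tc_scale c f) = tc_scale c (lin k f)"
proof -
  have "Poly_Mapping.keys (tc_scale c f) \<subseteq> Poly_Mapping.keys f"
    by (auto simp: in_keys_iff lookup_tc_scale)
  then have "lin k (tc_scale c f) =
      (\<Sum>t\<in>Poly_Mapping.keys f. tc_scale (Poly_Mapping.lookup (tc_scale c f) t) (k t))"
    by (intro lin_superset) auto
  then show ?thesis
    by (simp add: lin_def lookup_tc_scale tc.scale_sum_right)
qed

lemma lin_single [simp]: "lin k (Poly_Mapping.single t c) = tc_scale c (k t)"
  using lin_superset[of "{t}" "Poly_Mapping.single t c" k] by simp

lemma linear_lin: "Vector_Spaces.linear tc_scale tc_scale (lin k)"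
  by (intro Vector_Spaces.linear_iff[THEN iffD2] conjI allI vector_space_tc_scale lin_add lin_scale)

lemma tc_eq_sum: "f = (\<Sum>t\<in>Poly_Mapping.keys f. Poly_Mapping.single t (Poly_Mapping.lookup f t))"
proof (rule poly_mapping_eqI)
  fix s
  show "Poly_Mapping.lookup f s =
      Poly_Mapping.lookup (\<Sum>t\<in>Poly_Mapping.keys f. Poly_Mapping.single t (Poly_Mapping.lookup f t)) s"
    by (simp add: lookup_sum lookup_single when_def in_keys_iff)
qed

lemma lin_id: "lin (\<lambda>t. Poly_Mapping.single t 1) f = f"
  unfolding lin_def using tc_eq_sum[of f] by simp

lemma tcomp_lin_left: "tcomp i f g = lin (\<lambda>t. lin (\<lambda>s. Poly_Mapping.single (graft i t s) 1) g) f"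
  by (simp add: tcomp_def lin_def tc.scale_sum_right)

lemma tcomp_lin_right: "tcomp i f g = lin (\<lambda>s. lin (\<lambda>t. Poly_Mapping.single (graft i t s) 1) f) g"
  unfolding tcomp_def lin_def
  by (subst sum.swap) (simp add: tc.scale_sum_right mult.commute)

lemma tcomp_single [simp]:
  "tcomp i (Poly_Mapping.single t c) (Poly_Mapping.single s d) = Poly_Mapping.single (graft i t s) (c * d)"
  by (simp add: tcomp_lin_left)

lemma linear_tcomp_left: "Vector_Spaces.linear tc_scale tc_scale (\<lambda>f. tcomp i f g)"
  unfolding tcomp_lin_left by (rule linear_lin)

lemma linear_tcomp_right: "Vector_Spaces.linear tc_scale tc_scale (tcomp i f)"
  unfolding tcomp_lin_right by (rule linear_lin)

abbreviation tc_linear where "tc_linear \<equiv> Vector_Spaces.linear tc_scale tc_scale"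

interpretation tcl: vector_space_pair
  "tc_scale :: 'k::field \<Rightarrow> ('g, 'k) tree_comb \<Rightarrow> ('g, 'k) tree_comb"
  "tc_scale :: 'k::field \<Rightarrow> ('h, 'k) tree_comb \<Rightarrow> ('h, 'k) tree_comb"
  by unfold_locales

lemmas tcomp_simps =
  tcl.linear_add[OF linear_tcomp_left] tcl.linear_add[OF linear_tcomp_right]
  tcl.linear_diff[OF linear_tcomp_left] tcl.linear_diff[OF linear_tcomp_right]
  tcl.linear_scale[OF linear_tcomp_left] tcl.linear_scale[OF linear_tcomp_right]
  tcl.linear_0[OF linear_tcomp_left] tcl.linear_0[OF linear_tcomp_right]

lemmas tcomp_sum_left = tcl.linear_sum[OF linear_tcomp_left]
lemmas tcomp_sum_right = tcl.linear_sum[OF linear_tcomp_right]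

abbreviation fspace :: "'g set \<Rightarrow> nat \<Rightarrow> ('g, 'k::field) tree_comb set" where
  "fspace G n \<equiv> opd_space (free_operad G) n"

lemma free_operad_simps [simp]:
  "opd_add (free_operad G) n f g = f + g"
  "opd_zero (free_operad G) n = 0"
  "opd_scale (free_operad G) n = tc_scale"
  "opd_unit (free_operad G) = Poly_Mapping.single Leaf 1"
  "opd_comp (free_operad G) m i n f g = tcomp i f g"
  by (simp_all add: free_operad_def tcomp_def)

lemma fspace_iff: "f \<in> fspace G n \<longleftrightarrow> (\<forall>t \<in> Poly_Mapping.keys f. size1 t = n \<and> set_tree t \<subseteq> G)"
  by (simp add: free_operad_def)

lemma subspace_fspace: "tc.subspace (fspace G n :: ('g, 'k::field) tree_comb set)"
proof (rule tc.subspaceI)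
  fix f g :: "('g, 'k) tree_comb" assume "f \<in> fspace G n" "g \<in> fspace G n"
  then show "f + g \<in> fspace G n"
    using Poly_Mapping.keys_add[of f g] unfolding fspace_iff by blast
next
  fix c and f :: "('g, 'k) tree_comb" assume "f \<in> fspace G n"
  then show "tc_scale c f \<in> fspace G n"
    by (auto simp: fspace_iff in_keys_iff lookup_tc_scale)
qed (simp add: fspace_iff)

lemma single_fspace: "size1 t = n \<Longrightarrow> set_tree t \<subseteq> G \<Longrightarrow> Poly_Mapping.single t c \<in> fspace G n"
  by (simp add: fspace_iff)

lemma fspace_eq_span:
  "(fspace G n :: ('g, 'k::field) tree_comb set) = tc.span ((\<lambda>t. Poly_Mapping.single t 1) ` {t. size1 t = n \<and> set_tree t \<subseteq> G})"
    (is "_ = tc.span ?B")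
proof
  show "fspace G n \<subseteq> tc.span ?B"
  proof
    fix f :: "('g, 'k) tree_comb" assume f: "f \<in> fspace G n"
    have "f = (\<Sum>t\<in>Poly_Mapping.keys f. tc_scale (Poly_Mapping.lookup f t) (Poly_Mapping.single t 1))"
      using tc_eq_sum[of f] by simp
    moreover have "\<dots> \<in> tc.span ?B"
      by (intro tc.span_sum tc.span_scale tc.span_base) (use f in \<open>auto simp: fspace_iff\<close>)
    ultimately show "f \<in> tc.span ?B" by simp
  qed
  show "tc.span ?B \<subseteq> fspace G n"
    by (rule tc.span_minimal) (auto simp: subspace_fspace single_fspace)
qed

lemma linear_eq_on_fspace:
  assumes "tc_linear k" "tc_linear k'"
    and "\<And>t. size1 t = n \<Longrightarrow> set_tree t \<subseteq> G \<Longrightarrow> k (Poly_Mapping.single t 1) = k' (Poly_Mapping.single t 1)"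
    and "f \<in> fspace G n"
  shows "k f = k' f"
  using assms tcl.linear_eq_on[of k k' f] unfolding fspace_eq_span by blast

lemma linear_fspace:
  assumes "tc_linear k" "tc.subspace W"
    and "\<And>t. size1 t = n \<Longrightarrow> set_tree t \<subseteq> G \<Longrightarrow> k (Poly_Mapping.single t 1) \<in> W"
    and "f \<in> fspace G n"
  shows "k f \<in> W"
  using assms tcl.linear_subspace_vimage[of k W]
    tc.span_minimal[of "(\<lambda>t. Poly_Mapping.single t 1) ` {t. size1 t = n \<and> set_tree t \<subseteq> G}" "k -` W"]
  unfolding fspace_eq_span by blast

lemma size1_graft: "1 \<le> i \<Longrightarrow> i \<le> size1 t \<Longrightarrow> size1 (graft i t s) = size1 t + size1 s - 1"
  by (induction t arbitrary: i) auto

lemma set_tree_graft: "set_tree (graft i t s) \<subseteq> set_tree t \<union> set_tree s"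
  by (induction i t s rule: graft.induct) auto

lemma tcomp_fspace:
  assumes "1 \<le> i" "i \<le> m" "f \<in> fspace G m" "g \<in> fspace G n"
  shows "tcomp i f g \<in> fspace G (m + n - 1)"
proof (rule linear_fspace[OF linear_tcomp_left subspace_fspace _ assms(3)])
  fix t :: "'a tree" assume t: "size1 t = m" "set_tree t \<subseteq> G"
  show "tcomp i (Poly_Mapping.single t 1) g \<in> fspace G (m + n - 1)"
  proof (rule linear_fspace[OF linear_tcomp_right subspace_fspace _ assms(4)])
    fix s :: "'a tree" assume "size1 s = n" "set_tree s \<subseteq> G"
    then show "tcomp i (Poly_Mapping.single t 1) (Poly_Mapping.single s 1) \<in> fspace G (m + n - 1)"
      using t assms set_tree_graft[of i t s] by (auto simp: size1_graft intro!: single_fspace)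
  qed
qed

section \<open>Extending a map on generators to all trees\<close>

lemma gen_fspace: "a \<in> G \<Longrightarrow> gen a \<in> fspace G 2"
  by (simp add: gen_def corolla_def single_fspace)

lemma size1_eq_2: "size1 t = 2 \<Longrightarrow> \<exists>a. t = corolla a"
  by (cases t rule: tree.exhaust; cases "left t"; cases "right t") (auto simp: corolla_def size1_size)

lemma single_Node:
  "tcomp 1 (tcomp 2 (gen a) (Poly_Mapping.single r c)) (Poly_Mapping.single l d) =
    Poly_Mapping.single (Node l a r) (c * d :: 'k::field)"
  by (simp add: gen_def corolla_def)

text \<open>Composing with the right subtree at input 2 before the left subtree at input 1 avoids
  any shift of indices.\<close>

fun ev :: "('g \<Rightarrow> ('h, 'k::field) tree_comb) \<Rightarrow> 'g tree \<Rightarrow> ('h, 'k) tree_comb" where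
  "ev h Leaf = Poly_Mapping.single Leaf 1"
| "ev h (Node l a r) = tcomp 1 (tcomp 2 (h a) (ev h r)) (ev h l)"

abbreviation lift :: "('g \<Rightarrow> ('h, 'k::field) tree_comb) \<Rightarrow> ('g, 'k) tree_comb \<Rightarrow> ('h, 'k) tree_comb" where
  "lift h \<equiv> lin (ev h)"

lemma ev_fspace:
  assumes "\<And>a. a \<in> G \<Longrightarrow> h a \<in> fspace H 2" "set_tree t \<subseteq> G"
  shows "ev h t \<in> fspace H (size1 t)"
  using assms(2)
proof (induction t)
  case (Node l a r)
  have "h a \<in> fspace H 2" "ev h l \<in> fspace H (size1 l)" "ev h r \<in> fspace H (size1 r)"
    using Node assms(1) by auto
  then have "tcomp 1 (tcomp 2 (h a) (ev h r)) (ev h l) \<in> fspace H ((2 + size1 r - 1) + size1 l - 1)"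
    using tcomp_fspace[of 2 2 "h a" H "ev h r" "size1 r"]
    by (intro tcomp_fspace[of 1 _ _ H "ev h l"]) auto
  then show ?case by (simp add: add.commute)
qed (simp add: single_fspace)

lemma lift_fspace:
  assumes "\<And>a. a \<in> G \<Longrightarrow> h a \<in> fspace H 2" "f \<in> fspace G n"
  shows "lift h f \<in> fspace H n"
  by (rule linear_fspace[OF linear_lin subspace_fspace _ assms(2)]) (use ev_fspace[OF assms(1)] in auto)

lemma tcomp_leaf_left: "tcomp i (Poly_Mapping.single Leaf 1) f = f"
proof -
  have "tcomp i (Poly_Mapping.single Leaf 1) f = lin (\<lambda>t. Poly_Mapping.single t 1) f"
    unfolding tcomp_lin_right by simp
  then show ?thesis by (simp add: lin_id)
qed

lemma tcomp_leaf_right: 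
  assumes "1 \<le> i" "i \<le> n" "f \<in> fspace G n"
  shows "tcomp i f (Poly_Mapping.single Leaf 1) = f"
proof -
  have "graft i t Leaf = t" if "1 \<le> i" "i \<le> size1 t" for i and t :: "'a tree"
    using that by (induction t arbitrary: i) auto
  then have "tcomp i f (Poly_Mapping.single Leaf 1) = (\<lambda>f. f) f"
    by (intro linear_eq_on_fspace[OF linear_tcomp_left tc.linear_ident _ assms(3)])
      (use assms in auto)
  then show ?thesis by simp
qed

lemma linear_eqI:
  assumes "tc_linear k" "tc_linear k'"
    and "\<And>t. k (Poly_Mapping.single t 1) = k' (Poly_Mapping.single t 1)"
  shows "k f = k' f"
proof -
  have "lin (\<lambda>t. Poly_Mapping.single t 1) f \<in> tc.span (range (\<lambda>t. Poly_Mapping.single t 1))"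
    unfolding lin_def by (intro tc.span_sum tc.span_scale tc.span_base) auto
  then have "f \<in> tc.span (range (\<lambda>t. Poly_Mapping.single t 1))"
    by (simp add: lin_id)
  then show ?thesis
    using assms tcl.linear_eq_on[of k k' f] by blast
qed

lemma linear_tcompL:
  assumes "tc_linear k"
  shows "tc_linear (\<lambda>x. tcomp i (k x) g)"
  using Vector_Spaces.linear_compose[OF assms linear_tcomp_left] unfolding o_def .

lemma linear_tcompR:
  assumes "tc_linear k"
  shows "tc_linear (\<lambda>x. tcomp i f (k x))"
  using Vector_Spaces.linear_compose[OF assms linear_tcomp_right] unfolding o_def .

lemma linear_linI:
  assumes "tc_linear k"
  shows "tc_linear (\<lambda>x. lin e (k x))"
  using Vector_Spaces.linear_compose[OF assms linear_lin] unfolding o_def .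

lemmas linear_intros = linear_tcompL linear_tcompR linear_linI tc.linear_ident

text \<open>\<open>f\<close> occupies the first \<open>m\<close> inputs of the composite, so input
  \<open>i\<close> is an input of \<open>f\<close>. Both sides are linear in \<open>x\<close>,
  \<open>f\<close>, \<open>g\<close> and \<open>e\<close>, and on trees the identity is the left
  branch of the recursion of \<open>graft\<close>.\<close>

lemma tcomp_node_left:
  assumes "x \<in> fspace G 2" "1 \<le> i" "i \<le> m" "f \<in> fspace G' m"
  shows "tcomp i (tcomp 1 (tcomp 2 x g) f) e = tcomp 1 (tcomp 2 x g) (tcomp i f e)"
proof (rule linear_eq_on_fspace[where k = "\<lambda>x. tcomp i (tcomp 1 (tcomp 2 x g) f) e" and k' = "\<lambda>x. tcomp 1 (tcomp 2 x g) (tcomp i f e)", OF _ _ _ assms(1)])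
  fix t :: "'a tree" assume "size1 t = 2"
  then obtain a where a: "t = corolla a" using size1_eq_2 by blast
  let ?x = "Poly_Mapping.single t (1::'b)"
  show "tcomp i (tcomp 1 (tcomp 2 ?x g) f) e = tcomp 1 (tcomp 2 ?x g) (tcomp i f e)"
  proof (rule linear_eq_on_fspace[where k = "\<lambda>f. tcomp i (tcomp 1 (tcomp 2 ?x g) f) e" and k' = "\<lambda>f. tcomp 1 (tcomp 2 ?x g) (tcomp i f e)", OF _ _ _ assms(4)])
    fix u :: "'a tree" assume u: "size1 u = m"
    let ?u = "Poly_Mapping.single u (1::'b)"
    show "tcomp i (tcomp 1 (tcomp 2 ?x g) ?u) e = tcomp 1 (tcomp 2 ?x g) (tcomp i ?u e)"
    proof (rule linear_eqI[where k = "\<lambda>g. tcomp i (tcomp 1 (tcomp 2 ?x g) ?u) e" and k' = "\<lambda>g. tcomp 1 (tcomp 2 ?x g) (tcomp i ?u e)"])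
      fix v :: "'a tree"
      let ?v = "Poly_Mapping.single v (1::'b)"
      show "tcomp i (tcomp 1 (tcomp 2 ?x ?v) ?u) e = tcomp 1 (tcomp 2 ?x ?v) (tcomp i ?u e)"
      proof (rule linear_eqI[where k = "\<lambda>e. tcomp i (tcomp 1 (tcomp 2 ?x ?v) ?u) e" and k' = "\<lambda>e. tcomp 1 (tcomp 2 ?x ?v) (tcomp i ?u e)"])
        fix w :: "'a tree"
        let ?w = "Poly_Mapping.single w (1::'b)"
        show "tcomp i (tcomp 1 (tcomp 2 ?x ?v) ?u) ?w = tcomp 1 (tcomp 2 ?x ?v) (tcomp i ?u ?w)"
          using u assms by (simp add: a corolla_def)
      qed (intro linear_intros)+
    qed (intro linear_intros)+
  qed (intro linear_intros)+
qed (intro linear_intros)+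

text \<open>The inputs after the first \<open>m\<close> belong to \<open>g\<close>, renumbered by
  subtracting \<open>m\<close>; otherwise the argument is that of
  \<open>tcomp_node_left\<close>.\<close>

lemma tcomp_node_right:
  assumes "x \<in> fspace G 2" "m < i" "f \<in> fspace G' m"
  shows "tcomp i (tcomp 1 (tcomp 2 x g) f) e = tcomp 1 (tcomp 2 x (tcomp (i - m) g e)) f"
proof (rule linear_eq_on_fspace[where k = "\<lambda>x. tcomp i (tcomp 1 (tcomp 2 x g) f) e" and k' = "\<lambda>x. tcomp 1 (tcomp 2 x (tcomp (i - m) g e)) f", OF _ _ _ assms(1)])
  fix t :: "'a tree" assume "size1 t = 2"
  then obtain a where a: "t = corolla a" using size1_eq_2 by blast
  let ?x = "Poly_Mapping.single t (1::'b)"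
  show "tcomp i (tcomp 1 (tcomp 2 ?x g) f) e = tcomp 1 (tcomp 2 ?x (tcomp (i - m) g e)) f"
  proof (rule linear_eq_on_fspace[where k = "\<lambda>f. tcomp i (tcomp 1 (tcomp 2 ?x g) f) e" and k' = "\<lambda>f. tcomp 1 (tcomp 2 ?x (tcomp (i - m) g e)) f", OF _ _ _ assms(3)])
    fix u :: "'a tree" assume u: "size1 u = m"
    let ?u = "Poly_Mapping.single u (1::'b)"
    show "tcomp i (tcomp 1 (tcomp 2 ?x g) ?u) e = tcomp 1 (tcomp 2 ?x (tcomp (i - m) g e)) ?u"
    proof (rule linear_eqI[where k = "\<lambda>g. tcomp i (tcomp 1 (tcomp 2 ?x g) ?u) e" and k' = "\<lambda>g. tcomp 1 (tcomp 2 ?x (tcomp (i - m) g e)) ?u"])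
      fix v :: "'a tree"
      let ?v = "Poly_Mapping.single v (1::'b)"
      show "tcomp i (tcomp 1 (tcomp 2 ?x ?v) ?u) e = tcomp 1 (tcomp 2 ?x (tcomp (i - m) ?v e)) ?u"
      proof (rule linear_eqI[where k = "\<lambda>e. tcomp i (tcomp 1 (tcomp 2 ?x ?v) ?u) e" and k' = "\<lambda>e. tcomp 1 (tcomp 2 ?x (tcomp (i - m) ?v e)) ?u"])
        fix w :: "'a tree"
        let ?w = "Poly_Mapping.single w (1::'b)"
        show "tcomp i (tcomp 1 (tcomp 2 ?x ?v) ?u) ?w = tcomp 1 (tcomp 2 ?x (tcomp (i - m) ?v ?w)) ?u"
          using u assms by (simp add: a corolla_def)
      qed (intro linear_intros)+
    qed (intro linear_intros)+
  qed (intro linear_intros)+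
qed (intro linear_intros)+

text \<open>Since \<open>ev\<close> preserves arities, the case distinction made by
  \<open>graft\<close> at a node is exactly the one between the two associativity laws
  above.\<close>

lemma ev_graft:
  assumes "\<And>a. a \<in> G \<Longrightarrow> h a \<in> fspace H 2" "set_tree t \<subseteq> G" "1 \<le> i" "i \<le> size1 t"
  shows "ev h (graft i t s) = tcomp i (ev h t) (ev h s)"
  using assms(2-4)
proof (induction t arbitrary: i)
  case Leaf
  then show ?case by (simp add: tcomp_leaf_left)
next
  case (Node l a r)
  have l: "ev h l \<in> fspace H (size1 l)"
    by (rule ev_fspace[OF assms(1)]) (use Node.prems in auto)
  have a: "h a \<in> fspace H 2" using Node.prems assms(1) by simp
  show ?case
  proof (cases "i \<le> size1 l")
    case True
    then show ?thesis
      using Node tcomp_node_left[OF a _ True l] by simp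
  next
    case False
    then show ?thesis
      using Node tcomp_node_right[OF a _ l, of i] by (simp add: not_le)
  qed
qed

lemma lift_tcomp:
  assumes h: "\<And>a. a \<in> G \<Longrightarrow> h a \<in> fspace H 2"
    and "1 \<le> i" "i \<le> m" "f \<in> fspace G m" "g \<in> fspace G n"
  shows "lift h (tcomp i f g) = tcomp i (lift h f) (lift h g)"
proof (rule linear_eq_on_fspace[where k = "\<lambda>f. lift h (tcomp i f g)"
      and k' = "\<lambda>f. tcomp i (lift h f) (lift h g)", OF _ _ _ assms(4)])
  fix t :: "'a tree" assume t: "size1 t = m" "set_tree t \<subseteq> G"
  show "lift h (tcomp i (Poly_Mapping.single t 1) g) =
      tcomp i (lift h (Poly_Mapping.single t 1)) (lift h g)"
    by (rule linear_eq_on_fspace[where k = "\<lambda>g. lift h (tcomp i (Poly_Mapping.single t 1) g)"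
          and k' = "\<lambda>g. tcomp i (lift h (Poly_Mapping.single t 1)) (lift h g)", OF _ _ _ assms(5)])
      (use t assms ev_graft[OF h] in \<open>auto intro!: linear_intros\<close>)
qed (auto intro!: linear_intros)

lemma lift_gen:
  assumes "h a \<in> fspace H 2"
  shows "lift h (gen a) = h a"
proof -
  have "tcomp 2 (h a) (Poly_Mapping.single Leaf 1) = h a"
    by (rule tcomp_leaf_right[OF _ _ assms]) auto
  moreover have "tcomp 1 (h a) (Poly_Mapping.single Leaf 1) = h a"
    by (rule tcomp_leaf_right[OF _ _ assms]) auto
  ultimately show ?thesis by (simp add: gen_def corolla_def)
qed

text \<open>Two mutually composable lifts can be tested on generators: each tree is built from
  generators by compositions, and both lifts respect these.\<close>

lemma lift_lift:
  fixes h :: "'h \<Rightarrow> ('g, 'k::field) tree_comb" and h' :: "'g \<Rightarrow> ('h, 'k) tree_comb"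
  assumes h: "\<And>a. a \<in> H \<Longrightarrow> h a \<in> fspace G 2"
    and h': "\<And>a. a \<in> G \<Longrightarrow> h' a \<in> fspace H 2"
    and inv: "\<And>a. a \<in> G \<Longrightarrow> lift h (h' a) = gen a"
    and f: "f \<in> fspace G n"
  shows "lift h (lift h' f) = f"
proof -
  have ev: "lift h (ev h' t) = Poly_Mapping.single t 1" if "set_tree t \<subseteq> G" for t
    using that
  proof (induction t)
    case (Node l a r)
    then have a: "h' a \<in> fspace H 2" and sub: "set_tree l \<subseteq> G" "set_tree r \<subseteq> G"
      using h' by auto
    have l: "ev h' l \<in> fspace H (size1 l)" and r: "ev h' r \<in> fspace H (size1 r)"
      by (rule ev_fspace[OF h']; use sub in simp)+
    have ar: "tcomp 2 (h' a) (ev h' r) \<in> fspace H (2 + size1 r - 1)"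
      by (rule tcomp_fspace[OF _ _ a r]) auto
    have "lift h (ev h' (Node l a r)) = lift h (tcomp 1 (tcomp 2 (h' a) (ev h' r)) (ev h' l))"
      by simp
    also have "\<dots> = tcomp 1 (lift h (tcomp 2 (h' a) (ev h' r))) (lift h (ev h' l))"
      by (rule lift_tcomp[OF h _ _ ar l]) auto
    also have "lift h (tcomp 2 (h' a) (ev h' r)) = tcomp 2 (lift h (h' a)) (lift h (ev h' r))"
      by (rule lift_tcomp[OF h _ _ a r]) auto
    also have "lift h (h' a) = gen a"
      using inv Node.prems by simp
    also have "lift h (ev h' l) = Poly_Mapping.single l 1"
      using Node by simp
    also have "lift h (ev h' r) = Poly_Mapping.single r 1"
      using Node by simp
    finally show ?case
      by (simp only: single_Node mult_1)
  qed simp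
  show ?thesis
  proof (rule linear_eq_on_fspace[where k = "\<lambda>x. lift h (lift h' x)" and k' = "\<lambda>x. x", OF _ _ _ f])
    fix t :: "'g tree" assume "set_tree t \<subseteq> G"
    then show "lift h (lift h' (Poly_Mapping.single t 1)) = Poly_Mapping.single t 1"
      using ev by simp
  qed (intro linear_intros)+
qed

lemma operad_iso_lift:
  assumes h: "\<And>a. a \<in> G \<Longrightarrow> h a \<in> fspace H 2" 
    and h': "\<And>a. a \<in> H \<Longrightarrow> h' a \<in> fspace G 2"
    and "\<And>a. a \<in> G \<Longrightarrow> lift h' (h a) = gen a"
    and "\<And>a. a \<in> H \<Longrightarrow> lift h (h' a) = gen a"
  shows "operad_iso (free_operad G) (free_operad H) (\<lambda>n. lift h)"
  unfolding operad_iso_def operad_hom_def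
proof (intro conjI allI impI ballI)
  fix n
  show "bij_betw (lift h) (fspace G n) (fspace H n)"
  proof (rule bij_betw_byWitness[where f' = "lift h'"])
    show "\<forall>f\<in>fspace G n. lift h' (lift h f) = f"
      using lift_lift[of H h' G h] assms by blast
    show "\<forall>f\<in>fspace H n. lift h (lift h' f) = f"
      using lift_lift[of G h H h'] assms by blast
    show "lift h ` fspace G n \<subseteq> fspace H n" "lift h' ` fspace H n \<subseteq> fspace G n"
      using lift_fspace[of G h H] lift_fspace[of H h' G] h h' by blast+
  qed
next
  fix m n i :: nat and f g :: "('a, 'c) tree_comb"
  assume "1 \<le> i \<and> i \<le> m" "f \<in> fspace G m" "g \<in> fspace G n"
  then show "lift h (opd_comp (free_operad G) m i n f g) =
      opd_comp (free_operad H) m i n (lift h f) (lift h g)"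
    using lift_tcomp[of G h H i m f g n] h by simp
qed (use lift_fspace[of G h H] h in \<open>simp_all add: lin_add lin_scale\<close>)

section \<open>Ideals and quotients\<close>

text \<open>The record \<open>ns_operad\<close> is bare data; this is the part of the operad
  structure on which the general arguments about ideals and quotients rest.\<close>

definition operad_closed :: "('k, 'x) ns_operad \<Rightarrow> bool" where
  "operad_closed P \<longleftrightarrow>
     (\<forall>n. opd_zero P n \<in> opd_space P n) \<and>
     (\<forall>n. \<forall>x \<in> opd_space P n. \<forall>y \<in> opd_space P n. opd_add P n x y \<in> opd_space P n) \<and>
     (\<forall>n c. \<forall>x \<in> opd_space P n. opd_scale P n c x \<in> opd_space P n) \<and>
     opd_unit P \<in> opd_space P 1 \<and>
     (\<forall>m n i. 1 \<le> i \<and> i \<le> m \<longrightarrow>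
        (\<forall>x \<in> opd_space P m. \<forall>y \<in> opd_space P n. opd_comp P m i n x y \<in> opd_space P (m + n - 1)))"

lemma operad_ideal_generated:
  assumes P: "operad_closed P" and R: "\<And>m. R m \<subseteq> opd_space P m"
  shows "operad_ideal P (generated_ideal P R)" and "R n \<subseteq> generated_ideal P R n"
proof -
  \<comment> \<open>The whole operad is an ideal containing \<open>R\<close>. The intersection is
    thus over a nonempty family and stays inside the components.\<close>
  have "operad_ideal P (opd_space P)"
    using P by (auto simp: operad_closed_def operad_ideal_def)
  then have sub: "generated_ideal P R n \<subseteq> opd_space P n" for n
    using R by (auto simp: generated_ideal_def)
  have mem: "x \<in> generated_ideal P R n \<longleftrightarrow> (\<forall>I. operad_ideal P I \<longrightarrow> (\<forall>m. R m \<subseteq> I m) \<longrightarrow> x \<in> I n)" for x n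
    unfolding generated_ideal_def by blast
  show "R n \<subseteq> generated_ideal P R n"
    unfolding mem subset_iff by blast
  have closed: "z \<in> generated_ideal P R n"
    if "\<And>I. operad_ideal P I \<Longrightarrow> (\<And>m. generated_ideal P R m \<subseteq> I m) \<Longrightarrow> z \<in> I n" for z n
    unfolding mem
  proof (intro allI impI)
    fix I assume I: "operad_ideal P I" "\<forall>m. R m \<subseteq> I m"
    then have "generated_ideal P R m \<subseteq> I m" for m
      by (auto simp: mem)
    then show "z \<in> I n" by (rule that[OF I(1)])
  qed
  show "operad_ideal P (generated_ideal P R)"
    unfolding operad_ideal_def[of P "generated_ideal P R"]
  proof (intro conjI allI ballI impI)
    fix n
    show "generated_ideal P R n \<subseteq> opd_space P n"
      by (rule sub)
    show "opd_zero P n \<in> generated_ideal P R n"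
      by (rule closed) (simp add: operad_ideal_def)
  next
    fix n x y assume "x \<in> generated_ideal P R n" "y \<in> generated_ideal P R n"
    then show "opd_add P n x y \<in> generated_ideal P R n"
      by (intro closed) (auto simp: operad_ideal_def subset_iff)
  next
    fix n c x assume "x \<in> generated_ideal P R n"
    then show "opd_scale P n c x \<in> generated_ideal P R n"
      by (intro closed) (auto simp: operad_ideal_def subset_iff)
  next
    fix m n i :: nat and x y
    assume i: "1 \<le> i \<and> i \<le> m" and xy: "x \<in> generated_ideal P R m" "y \<in> opd_space P n"
    show "opd_comp P m i n x y \<in> generated_ideal P R (m + n - 1)"
    proof (rule closed)
      fix I assume "operad_ideal P I" "\<And>m. generated_ideal P R m \<subseteq> I m"
      moreover from this have "x \<in> I m" using xy by blast
      ultimately show "opd_comp P m i n x y \<in> I (m + n - 1)"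
        using i xy unfolding operad_ideal_def by simp
    qed
  next
    fix m n i :: nat and x y
    assume i: "1 \<le> i \<and> i \<le> m" and xy: "x \<in> opd_space P m" "y \<in> generated_ideal P R n"
    show "opd_comp P m i n x y \<in> generated_ideal P R (m + n - 1)"
    proof (rule closed)
      fix I assume "operad_ideal P I" "\<And>m. generated_ideal P R m \<subseteq> I m"
      moreover from this have "y \<in> I n" using xy by blast
      ultimately show "opd_comp P m i n x y \<in> I (m + n - 1)"
        using i xy unfolding operad_ideal_def by simp
    qed
  qed
qed

lemma generated_ideal_minimal:
  "operad_ideal P I \<Longrightarrow> (\<And>m. R m \<subseteq> I m) \<Longrightarrow> generated_ideal P R n \<subseteq> I n"
  unfolding generated_ideal_def by blast

text \<open>Closure under composition with arbitrary elements of \<open>Q\<close> uses that each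
  component of \<phi> is onto. Preservation of zero is not among the clauses of
  \<open>operad_hom\<close>, hence the assumption \<open>zero\<close>.\<close>

lemma operad_ideal_image:
  assumes iso: "operad_iso P Q \<phi>" and zero: "\<And>n. \<phi> n (opd_zero P n) = opd_zero Q n"
    and I: "operad_ideal P I"
  shows "operad_ideal Q (\<lambda>n. \<phi> n ` I n)"
proof -
  have sub: "I n \<subseteq> opd_space P n" for n
    using I by (simp add: operad_ideal_def)
  have img: "\<phi> n ` opd_space P n = opd_space Q n" for n
    using iso by (simp add: operad_iso_def bij_betw_def)
  have hom: "operad_hom P Q \<phi>"
    using iso by (simp add: operad_iso_def)
  show ?thesis
    unfolding operad_ideal_def
  proof (intro conjI allI ballI impI)
    fix n
    show "\<phi> n ` I n \<subseteq> opd_space Q n"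
      using sub img by blast
    show "opd_zero Q n \<in> \<phi> n ` I n"
      unfolding zero[symmetric] using I by (auto simp: operad_ideal_def)
  next
    fix n x y assume "x \<in> \<phi> n ` I n" "y \<in> \<phi> n ` I n"
    then obtain u v where uv: "u \<in> I n" "v \<in> I n" "x = \<phi> n u" "y = \<phi> n v" by blast
    then have "opd_add P n u v \<in> I n"
      using I by (simp add: operad_ideal_def)
    moreover have "opd_add Q n x y = \<phi> n (opd_add P n u v)"
      using hom uv sub by (simp add: operad_hom_def subset_iff)
    ultimately show "opd_add Q n x y \<in> \<phi> n ` I n" by blast
  next
    fix n c x assume "x \<in> \<phi> n ` I n"
    then obtain u where u: "u \<in> I n" "x = \<phi> n u" by blast
    then have "opd_scale P n c u \<in> I n"
      using I by (simp add: operad_ideal_def)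
    moreover have "opd_scale Q n c x = \<phi> n (opd_scale P n c u)"
      using hom u sub by (simp add: operad_hom_def subset_iff)
    ultimately show "opd_scale Q n c x \<in> \<phi> n ` I n" by blast
  next
    fix m n i :: nat and x y assume i: "1 \<le> i \<and> i \<le> m" and "x \<in> \<phi> m ` I m" "y \<in> opd_space Q n"
    then obtain u v where uv: "u \<in> I m" "v \<in> opd_space P n" "x = \<phi> m u" "y = \<phi> n v"
      using img[of n] by blast
    then have "opd_comp P m i n u v \<in> I (m + n - 1)"
      using I i unfolding operad_ideal_def by blast
    moreover have "opd_comp Q m i n x y = \<phi> (m + n - 1) (opd_comp P m i n u v)"
      using hom uv sub[of m] i unfolding operad_hom_def by (simp add: subset_iff)
    ultimately show "opd_comp Q m i n x y \<in> \<phi> (m + n - 1) ` I (m + n - 1)" by blast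
  next
    fix m n i :: nat and x y assume i: "1 \<le> i \<and> i \<le> m" and "x \<in> opd_space Q m" "y \<in> \<phi> n ` I n"
    then obtain u v where uv: "u \<in> opd_space P m" "v \<in> I n" "x = \<phi> m u" "y = \<phi> n v"
      using img[of m] by blast
    then have "opd_comp P m i n u v \<in> I (m + n - 1)"
      using I i unfolding operad_ideal_def by blast
    moreover have "opd_comp Q m i n x y = \<phi> (m + n - 1) (opd_comp P m i n u v)"
      using hom uv sub[of n] i unfolding operad_hom_def by (simp add: subset_iff)
    ultimately show "opd_comp Q m i n x y \<in> \<phi> (m + n - 1) ` I (m + n - 1)" by blast
  qed
qed

lemma operad_ideal_vimage:
  assumes P: "operad_closed P" and hom: "operad_hom P Q \<phi>"
    and zero: "\<And>n. \<phi> n (opd_zero P n) = opd_zero Q n" and J: "operad_ideal Q J"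
  shows "operad_ideal P (\<lambda>n. {x \<in> opd_space P n. \<phi> n x \<in> J n})"
  unfolding operad_ideal_def
proof (intro conjI allI ballI impI)
  fix m n i :: nat and x y
  assume i: "1 \<le> i \<and> i \<le> m"
    and xy: "x \<in> {x \<in> opd_space P m. \<phi> m x \<in> J m}" "y \<in> opd_space P n"
  then have "opd_comp P m i n x y \<in> opd_space P (m + n - 1)"
    using P unfolding operad_closed_def by blast
  moreover have "\<phi> (m + n - 1) (opd_comp P m i n x y) = opd_comp Q m i n (\<phi> m x) (\<phi> n y)"
    using hom i xy unfolding operad_hom_def by simp
  moreover have "\<phi> n y \<in> opd_space Q n"
    using hom xy by (simp add: operad_hom_def)
  ultimately show "opd_comp P m i n x y \<in> {x \<in> opd_space P (m + n - 1). \<phi> (m + n - 1) x \<in> J (m + n - 1)}"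
    using J i xy unfolding operad_ideal_def by simp
next
  fix m n i :: nat and x y
  assume i: "1 \<le> i \<and> i \<le> m"
    and xy: "x \<in> opd_space P m" "y \<in> {x \<in> opd_space P n. \<phi> n x \<in> J n}"
  then have "opd_comp P m i n x y \<in> opd_space P (m + n - 1)"
    using P unfolding operad_closed_def by blast
  moreover have "\<phi> (m + n - 1) (opd_comp P m i n x y) = opd_comp Q m i n (\<phi> m x) (\<phi> n y)"
    using hom i xy unfolding operad_hom_def by simp
  moreover have "\<phi> m x \<in> opd_space Q m"
    using hom xy by (simp add: operad_hom_def)
  ultimately show "opd_comp P m i n x y \<in> {x \<in> opd_space P (m + n - 1). \<phi> (m + n - 1) x \<in> J (m + n - 1)}"
    using J i xy unfolding operad_ideal_def by simp
qed (use assms in \<open>auto simp: operad_ideal_def operad_hom_def operad_closed_def\<close>)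

text \<open>For one inclusion, the preimage of an ideal containing the images of \<open>R\<close> is
  an ideal containing \<open>R\<close>; for the other, the image of the generated ideal is an ideal
  because \<phi> is onto.\<close>

lemma generated_ideal_image:
  assumes P: "operad_closed P" and iso: "operad_iso P Q \<phi>"
    and zero: "\<And>n. \<phi> n (opd_zero P n) = opd_zero Q n" and R: "\<And>m. R m \<subseteq> opd_space P m"
  shows "\<phi> n ` generated_ideal P R n = generated_ideal Q (\<lambda>n. \<phi> n ` R n) n"
proof
  have hom: "operad_hom P Q \<phi>"
    using iso by (simp add: operad_iso_def)
  have "\<phi> n x \<in> J n"
    if J: "operad_ideal Q J" "\<And>m. \<phi> m ` R m \<subseteq> J m" and x: "x \<in> generated_ideal P R n" for J x
  proof -
    have "generated_ideal P R n \<subseteq> {x \<in> opd_space P n. \<phi> n x \<in> J n}"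
      using R J(2)
      by (intro generated_ideal_minimal[OF operad_ideal_vimage[OF P hom zero J(1)]]) blast
    then show ?thesis using x by blast
  qed
  then show "\<phi> n ` generated_ideal P R n \<subseteq> generated_ideal Q (\<lambda>n. \<phi> n ` R n) n"
    unfolding generated_ideal_def[of Q] by blast
  show "generated_ideal Q (\<lambda>n. \<phi> n ` R n) n \<subseteq> \<phi> n ` generated_ideal P R n"
    by (rule generated_ideal_minimal[OF operad_ideal_image[OF iso zero]])
      (use operad_ideal_generated[OF P R] in blast)+
qed

text \<open>The operations on cosets are unions over all representatives and direct images commute
  with unions, so everything reduces to the image of a single coset. Injectivity on cosets is that
  of the direct image on subsets of a set where \<phi> is injective.\<close>

lemma operad_iso_quotient:
  assumes P: "operad_closed P" and iso: "operad_iso P Q \<phi>" and sub: "\<And>n. I n \<subseteq> opd_space P n"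
  shows "operad_iso (quotient_operad P I) (quotient_operad Q (\<lambda>n. \<phi> n ` I n)) (\<lambda>n. (`) (\<phi> n))"
    and "x \<in> opd_space P n \<Longrightarrow>
      \<phi> n ` opd_coset P I n x = opd_coset Q (\<lambda>n. \<phi> n ` I n) n (\<phi> n x)"
proof -
  let ?J = "\<lambda>n. \<phi> n ` I n"
  have hom: "operad_hom P Q \<phi>"
    using iso by (simp add: operad_iso_def)
  have coset: "\<phi> n ` opd_coset P I n x = opd_coset Q ?J n (\<phi> n x)" if "x \<in> opd_space P n" for n x
  proof -
    have "\<phi> n (opd_add P n x y) = opd_add Q n (\<phi> n x) (\<phi> n y)" if "y \<in> I n" for y
      using hom \<open>x \<in> opd_space P n\<close> that sub[of n] by (auto simp: operad_hom_def)
    then show ?thesis by (auto simp: opd_coset_def image_image)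
  qed
  then show "x \<in> opd_space P n \<Longrightarrow> \<phi> n ` opd_coset P I n x = opd_coset Q ?J n (\<phi> n x)" .
  have space: "X \<subseteq> opd_space P n" if "X \<in> opd_space (quotient_operad P I) n" for X n
    using that P sub[of n] by (auto simp: quotient_operad_def opd_coset_def operad_closed_def)
  show "operad_iso (quotient_operad P I) (quotient_operad Q ?J) (\<lambda>n. (`) (\<phi> n))"
    unfolding operad_iso_def operad_hom_def
  proof (intro conjI allI ballI impI)
    fix n
    have "inj_on (\<phi> n) (opd_space P n)" and img: "\<phi> n ` opd_space P n = opd_space Q n"
      using iso by (auto simp: operad_iso_def bij_betw_def)
    then have "inj_on ((`) (\<phi> n)) (opd_space (quotient_operad P I) n)"
      using space by (intro inj_on_subset[OF inj_on_image_Pow]) blast+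
    moreover have "(`) (\<phi> n) ` opd_space (quotient_operad P I) n = opd_space (quotient_operad Q ?J) n"
      using coset by (simp add: quotient_operad_def image_image img[symmetric])
    ultimately show "bij_betw ((`) (\<phi> n)) (opd_space (quotient_operad P I) n)
        (opd_space (quotient_operad Q ?J) n)"
      by (simp add: bij_betw_def)
  next
    fix n X assume "X \<in> opd_space (quotient_operad P I) n"
    then obtain x where "x \<in> opd_space P n" "X = opd_coset P I n x"
      by (auto simp: quotient_operad_def)
    then show "\<phi> n ` X \<in> opd_space (quotient_operad Q ?J) n"
      using coset hom by (simp add: quotient_operad_def operad_hom_def)
  next
    fix n X Y
    assume "X \<in> opd_space (quotient_operad P I) n" "Y \<in> opd_space (quotient_operad P I) n"
    then have XY: "X \<subseteq> opd_space P n" "Y \<subseteq> opd_space P n" by (simp_all add: space)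
    have "\<phi> n ` opd_coset P I n (opd_add P n x y) = opd_coset Q ?J n (opd_add Q n (\<phi> n x) (\<phi> n y))"
      if "x \<in> X" "y \<in> Y" for x y
    proof -
      have "x \<in> opd_space P n" "y \<in> opd_space P n" using XY that by auto
      then show ?thesis
        using coset P hom by (simp add: operad_closed_def operad_hom_def)
    qed
    then show "\<phi> n ` opd_add (quotient_operad P I) n X Y =
        opd_add (quotient_operad Q ?J) n (\<phi> n ` X) (\<phi> n ` Y)"
      by (simp add: quotient_operad_def image_UN)
  next
    fix n c X assume "X \<in> opd_space (quotient_operad P I) n"
    then have X: "X \<subseteq> opd_space P n" by (simp add: space)
    have "\<phi> n ` opd_coset P I n (opd_scale P n c x) = opd_coset Q ?J n (opd_scale Q n c (\<phi> n x))"
      if "x \<in> X" for x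
    proof -
      have "x \<in> opd_space P n" using X that by auto
      then show ?thesis
        using coset P hom by (simp add: operad_closed_def operad_hom_def)
    qed
    then show "\<phi> n ` opd_scale (quotient_operad P I) n c X =
        opd_scale (quotient_operad Q ?J) n c (\<phi> n ` X)"
      by (simp add: quotient_operad_def image_UN)
  next
    show "\<phi> 1 ` opd_unit (quotient_operad P I) = opd_unit (quotient_operad Q ?J)"
      using coset[of "opd_unit P" 1] P hom
      by (simp add: quotient_operad_def operad_closed_def operad_hom_def)
  next
    fix m n i :: nat and X Y
    assume i: "1 \<le> i \<and> i \<le> m"
      and "X \<in> opd_space (quotient_operad P I) m" "Y \<in> opd_space (quotient_operad P I) n"
    then have XY: "X \<subseteq> opd_space P m" "Y \<subseteq> opd_space P n" by (simp_all add: space)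
    have "\<phi> (m + n - 1) ` opd_coset P I (m + n - 1) (opd_comp P m i n x y) =
        opd_coset Q ?J (m + n - 1) (opd_comp Q m i n (\<phi> m x) (\<phi> n y))"
      if "x \<in> X" "y \<in> Y" for x y
    proof -
      have xy: "x \<in> opd_space P m" "y \<in> opd_space P n" using XY that by auto
      then have "opd_comp P m i n x y \<in> opd_space P (m + n - 1)"
        using P i unfolding operad_closed_def by blast
      moreover have "\<phi> (m + n - 1) (opd_comp P m i n x y) = opd_comp Q m i n (\<phi> m x) (\<phi> n y)"
        using hom i xy unfolding operad_hom_def by blast
      ultimately show ?thesis
        using coset by simp
    qed
    then show "\<phi> (m + n - 1) ` opd_comp (quotient_operad P I) m i n X Y =
        opd_comp (quotient_operad Q ?J) m i n (\<phi> m ` X) (\<phi> n ` Y)"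
      by (simp add: quotient_operad_def image_UN)
  qed
qed

section \<open>Quotients of free operads and uniqueness of morphisms out of them\<close>

lemma operad_closed_free:
  fixes G :: "'g set"
  shows "operad_closed (free_operad G :: ('k::field, ('g, 'k) tree_comb) ns_operad)"
  unfolding operad_closed_def
proof (intro conjI allI ballI impI)
  fix m n i :: nat and f g :: "('g, 'k) tree_comb"
  assume "1 \<le> i \<and> i \<le> m" "f \<in> fspace G m" "g \<in> fspace G n"
  then show "opd_comp (free_operad G) m i n f g \<in> fspace G (m + n - 1)"
    using tcomp_fspace[of i m f G g n] by simp
qed (simp_all add: single_fspace tc.subspace_0[OF subspace_fspace]
  tc.subspace_add[OF subspace_fspace] tc.subspace_scale[OF subspace_fspace])

lemma opd_coset_free: "opd_coset (free_operad G) I n f = (+) f ` I n"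
proof -
  have "opd_add (free_operad G) n f = (+) f" by (rule ext) simp
  then show ?thesis by (simp add: opd_coset_def)
qed

lemma subspace_ideal: "operad_ideal (free_operad G) I \<Longrightarrow> tc.subspace (I n)"
  by (intro tc.subspaceI) (simp_all add: operad_ideal_def)

lemma opd_coset_free_eq:
  assumes I: "operad_ideal (free_operad G) I" and fg: "f - g \<in> I n"
  shows "opd_coset (free_operad G) I n f = opd_coset (free_operad G) I n g"
proof -
  have S: "tc.subspace (I n)" by (rule subspace_ideal[OF I])
  have *: "(+) f ` I n \<subseteq> (+) g ` I n" if "f - g \<in> I n" for f g
  proof
    fix x assume "x \<in> (+) f ` I n"
    then obtain u where "u \<in> I n" "x = f + u" by blast
    then have "x = g + ((f - g) + u)" "(f - g) + u \<in> I n"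
      using tc.subspace_add[OF S that] by simp_all
    then show "x \<in> (+) g ` I n" by blast
  qed
  have "g - f \<in> I n"
    using tc.subspace_neg[OF S fg] by simp
  with * fg show ?thesis unfolding opd_coset_free by blast
qed

text \<open>The elements of the free operad on whose classes the two morphisms agree, collected in
  \<open>E\<close>, form subspaces closed under composition. They contain the unit and the
  generators, hence all trees.\<close>

lemma quotient_free_hom_unique:
  fixes G :: "'g set" and H :: "'h set"
    and I :: "nat \<Rightarrow> ('g, 'k::field) tree_comb set" and J :: "nat \<Rightarrow> ('h, 'k) tree_comb set"
  defines "P \<equiv> quotient_operad (free_operad G) I" and "Q \<equiv> quotient_operad (free_operad H) J"
  defines "cl \<equiv> opd_coset (free_operad G) I"
  assumes I: "operad_ideal (free_operad G) I" and J: "operad_ideal (free_operad H) J"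
    and hom: "operad_hom P Q \<phi>" "operad_hom P Q \<psi>"
    and gens: "\<And>a. a \<in> G \<Longrightarrow> \<phi> 2 (cl 2 (gen a)) = \<psi> 2 (cl 2 (gen a))"
    and x: "x \<in> opd_space P n"
  shows "\<phi> n x = \<psi> n x"
proof -
  have I_sub: "tc.subspace (I n)" for n by (rule subspace_ideal[OF I])
  have self: "f \<in> cl n f" for f n
    using tc.subspace_0[OF I_sub, of n] image_iff[of f "(+) f" "I n"] by (auto simp: cl_def opd_coset_free)
  have mem: "x - f \<in> I n" if "x \<in> cl n f" for x f n
    using that by (auto simp: cl_def opd_coset_free)
  have I_fspace: "I n \<subseteq> fspace G n" for n
    using I by (simp add: operad_ideal_def)
  have space: "cl n f \<in> opd_space P n" if "f \<in> fspace G n" for f n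
    using that by (simp add: P_def cl_def quotient_operad_def)
  have cl_eq: "cl n f = cl n g" if "f - g \<in> I n" for f g n
    unfolding cl_def by (rule opd_coset_free_eq[OF I that])
  have add: "opd_add P n (cl n f) (cl n g) = cl n (f + g)" for f g n
  proof -
    have "cl n (x + y) = cl n (f + g)" if "x \<in> cl n f" "y \<in> cl n g" for x y
      using tc.subspace_add[OF I_sub mem[OF that(1)] mem[OF that(2)]]
      by (intro cl_eq) (simp add: algebra_simps)
    \<comment> \<open>All cosets in the union coincide; \<open>self\<close> supplies the
      nonemptiness of the index sets.\<close>
    then have "(\<Union>x\<in>cl n f. \<Union>y\<in>cl n g. cl n (x + y)) = cl n (f + g)"
      using self by (intro SUP_eq_const) blast+
    then show ?thesis by (simp add: P_def quotient_operad_def cl_def)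
  qed
  have scale: "opd_scale P n c (cl n f) = cl n (tc_scale c f)" for f n c
  proof -
    have "cl n (tc_scale c x) = cl n (tc_scale c f)" if "x \<in> cl n f" for x
      using tc.subspace_scale[OF I_sub mem[OF that], of c]
      by (intro cl_eq) (simp add: tc.scale_right_diff_distrib)
    then have "(\<Union>x\<in>cl n f. cl n (tc_scale c x)) = cl n (tc_scale c f)"
      using self by (intro SUP_eq_const) blast+
    then show ?thesis by (simp add: P_def quotient_operad_def cl_def)
  qed
  have comp: "opd_comp P m i n (cl m f) (cl n g) = cl (m + n - 1) (tcomp i f g)"
    if i: "1 \<le> i" "i \<le> m" and f: "f \<in> fspace G m" and g: "g \<in> fspace G n" for f g m n i
  proof -
    have "cl (m + n - 1) (tcomp i x y) = cl (m + n - 1) (tcomp i f g)"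
      if xy: "x \<in> cl m f" "y \<in> cl n g" for x y
    proof (rule cl_eq)
      have "y = g + (y - g)" "y - g \<in> fspace G n"
        using mem[OF xy(2)] I_fspace by auto
      then have y: "y \<in> fspace G n"
        using tc.subspace_add[OF subspace_fspace g] by metis
      have "tcomp i (x - f) y \<in> I (m + n - 1)" "tcomp i f (y - g) \<in> I (m + n - 1)"
        using I i f y mem[OF xy(1)] mem[OF xy(2)] by (auto simp: operad_ideal_def)
      from tc.subspace_add[OF I_sub this]
      show "tcomp i x y - tcomp i f g \<in> I (m + n - 1)"
        by (simp add: tcomp_simps)
    qed
    then have "(\<Union>x\<in>cl m f. \<Union>y\<in>cl n g. cl (m + n - 1) (tcomp i x y)) = cl (m + n - 1) (tcomp i f g)"
      using self by (intro SUP_eq_const) blast+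
    then show ?thesis by (simp add: P_def quotient_operad_def cl_def)
  qed
  define E where "E n = {f \<in> fspace G n. \<phi> n (cl n f) = \<psi> n (cl n f)}" for n
  have E_comp: "tcomp i f g \<in> E (m + n - 1)"
    if "1 \<le> i" "i \<le> m" "f \<in> E m" "g \<in> E n" for i m n f g
  proof -
    have fg: "f \<in> fspace G m" "g \<in> fspace G n" using that by (auto simp: E_def)
    have "\<theta> (m + n - 1) (cl (m + n - 1) (tcomp i f g)) = opd_comp Q m i n (\<theta> m (cl m f)) (\<theta> n (cl n g))"
      if "operad_hom P Q \<theta>" for \<theta>
      using that space[OF fg(1)] space[OF fg(2)] \<open>1 \<le> i\<close> \<open>i \<le> m\<close>
      unfolding operad_hom_def comp[OF \<open>1 \<le> i\<close> \<open>i \<le> m\<close> fg, symmetric] by simp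
    from this[OF hom(1)] this[OF hom(2)] that show ?thesis
      using tcomp_fspace[OF _ _ fg] by (simp add: E_def)
  qed
  have E_scale: "tc_scale c f \<in> E n" if "f \<in> E n" for c f n
  proof -
    have "\<theta> n (cl n (tc_scale c f)) = opd_scale Q n c (\<theta> n (cl n f))" if "operad_hom P Q \<theta>" for \<theta>
      using that \<open>f \<in> E n\<close> space[of f n] unfolding operad_hom_def scale[symmetric] by (simp add: E_def)
    from this[OF hom(1)] this[OF hom(2)] that show ?thesis
      using tc.subspace_scale[OF subspace_fspace] by (auto simp: E_def)
  qed
  have E_add: "f + g \<in> E n" if fg: "f \<in> E n" "g \<in> E n" for f g n
  proof -
    have "\<theta> n (cl n (f + g)) = opd_add Q n (\<theta> n (cl n f)) (\<theta> n (cl n g))" if "operad_hom P Q \<theta>" for \<theta>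
      using that fg space[of f n] space[of g n] unfolding operad_hom_def add[symmetric] by (simp add: E_def)
    from this[OF hom(1)] this[OF hom(2)] fg show ?thesis
      using tc.subspace_add[OF subspace_fspace] by (auto simp: E_def)
  qed
  \<comment> \<open>Preservation of zero has to be derived from that of scalar multiples: the zero
    class is 0 times itself, and 0 times any coset of the target is the zero coset.\<close>
  have E_0: "0 \<in> E n" for n
  proof -
    have zero: "0 \<in> fspace G n" by (rule tc.subspace_0[OF subspace_fspace])
    have "\<theta> n (cl n 0) = opd_coset (free_operad H) J n 0" if \<theta>: "operad_hom P Q \<theta>" for \<theta>
    proof -
      have "\<theta> n (cl n 0) \<in> opd_space Q n"
        using \<theta> space[OF zero] by (simp add: operad_hom_def)
      then obtain g where g: "\<theta> n (cl n 0) = opd_coset (free_operad H) J n g"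
        by (auto simp: Q_def quotient_operad_def)
      have "opd_coset (free_operad H) J n g \<noteq> {}"
        using tc.subspace_0[OF subspace_ideal[OF J]] by (auto simp: opd_coset_free)
      then have "opd_scale Q n 0 (opd_coset (free_operad H) J n g) = opd_coset (free_operad H) J n 0"
        by (simp add: Q_def quotient_operad_def)
      moreover have "\<theta> n (opd_scale P n 0 (cl n 0)) = opd_scale Q n 0 (\<theta> n (cl n 0))"
        using \<theta> space[OF zero] by (simp add: operad_hom_def)
      moreover have "opd_scale P n 0 (cl n 0) = cl n 0"
        using scale[of n 0 0] by simp
      ultimately show ?thesis
        by (simp add: g)
    qed
    from this[OF hom(1)] this[OF hom(2)] show ?thesis
      using zero by (simp add: E_def)
  qed
  have E_tree: "Poly_Mapping.single t 1 \<in> E (size1 t)" if "set_tree t \<subseteq> G" for t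
    using that
  proof (induction t)
    case Leaf
    have "\<theta> 1 (cl 1 (Poly_Mapping.single Leaf 1)) = opd_unit Q" if "operad_hom P Q \<theta>" for \<theta>
      using that by (simp add: operad_hom_def P_def quotient_operad_def cl_def)
    from this[OF hom(1)] this[OF hom(2)] show ?case
      by (simp add: E_def single_fspace)
  next
    case (Node l a r)
    have "gen a \<in> E 2"
      using gens Node.prems by (simp add: E_def gen_fspace)
    then have "tcomp 2 (gen a) (Poly_Mapping.single r 1) \<in> E (2 + size1 r - 1)"
      by (rule E_comp[rotated 2]) (use Node in auto)
    then have "tcomp 1 (tcomp 2 (gen a) (Poly_Mapping.single r 1)) (Poly_Mapping.single l 1)
        \<in> E ((2 + size1 r - 1) + size1 l - 1)"
      by (rule E_comp[rotated 2]) (use Node in auto)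
    then show ?case
      unfolding single_Node by (simp add: add.commute)
  qed
  obtain f where f: "f \<in> fspace G n" "x = cl n f"
    using x by (auto simp: P_def quotient_operad_def cl_def)
  have "tc.subspace (E n)"
    by (intro tc.subspaceI E_0 E_add E_scale)
  then have "f \<in> E n"
    by (rule linear_fspace[OF tc.linear_ident _ _ f(1)]) (use E_tree in auto)
  then show ?thesis using f by (simp add: E_def)
qed

section \<open>The dual order of a thin forest poset\<close>

text \<open>The strict descendant relation. The recursive form suits induction along trees;
  agreement with the transitive closure of the edges is \<open>trancl_forest_edges\<close>.\<close>

primrec tree_order :: "'a rtree \<Rightarrow> 'a rel" where
  "tree_order (RNode a ts) =
     {a} \<times> set (concat (map preorder ts)) \<union> \<Union> (set (map tree_order ts))"

lemma root_in_preorder: "root t \<in> set (preorder t)"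
  by (cases t) simp

lemma tree_order_Field: "tree_order t \<subseteq> set (preorder t) \<times> set (preorder t)"
  by (induction t) fastforce

lemma tree_edges_subset_order: "tree_edges t \<subseteq> tree_order t"
proof (induction t)
  case (RNode a ts)
  then show ?case using root_in_preorder by fastforce
qed

lemma root_tree_edges_reach:
  "b \<in> set (preorder t) \<Longrightarrow> (root t, b) \<in> (tree_edges t)\<^sup>*"
proof (induction t arbitrary: b)
  case (RNode a ts)
  show ?case
  proof (cases "b = a")
    case False
    then obtain t where t: "t \<in> set ts" "b \<in> set (preorder t)"
      using RNode.prems by auto
    have "tree_edges t \<subseteq> tree_edges (RNode a ts)"
      using t by auto
    then have "(root t, b) \<in> (tree_edges (RNode a ts))\<^sup>*"
      using RNode.IH[OF t] rtrancl_mono by blast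
    moreover have "(a, root t) \<in> tree_edges (RNode a ts)"
      using t by auto
    ultimately show ?thesis by (simp add: converse_rtrancl_into_rtrancl)
  qed simp
qed

lemma tree_order_subset_trancl: "tree_order t \<subseteq> (tree_edges t)\<^sup>+"
proof (induction t)
  case (RNode a ts)
  have "(a, b) \<in> (tree_edges (RNode a ts))\<^sup>+" if "t \<in> set ts" "b \<in> set (preorder t)" for b t
  proof -
    have "(root t, b) \<in> (tree_edges (RNode a ts))\<^sup>*"
      using root_tree_edges_reach[OF that(2)] that(1) rtrancl_mono[of "tree_edges t" "tree_edges (RNode a ts)"]
      by auto
    moreover have "(a, root t) \<in> tree_edges (RNode a ts)"
      using that by auto
    ultimately show ?thesis by (rule rtrancl_into_trancl2[rotated])
  qed
  moreover have "tree_order t \<subseteq> (tree_edges (RNode a ts))\<^sup>+" if "t \<in> set ts" for t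
  proof -
    have "tree_edges t \<subseteq> tree_edges (RNode a ts)" using that by auto
    then show ?thesis using RNode[OF that] trancl_mono_subset by blast
  qed
  ultimately show ?case by auto
qed

section \<open>The order carried by a planar forest\<close>

abbreviation forest_nodes :: "'a rtree list \<Rightarrow> 'a list" where
  "forest_nodes ts \<equiv> concat (map preorder ts)"

definition forest_order :: "'a rtree list \<Rightarrow> 'a rel" where
  "forest_order ts = (\<Union>t\<in>set ts. tree_order t)"

lemma forest_nodes_disjoint:
  assumes "distinct (forest_nodes ts)" "t \<in> set ts" "u \<in> set ts"
    and "x \<in> set (preorder t)" "x \<in> set (preorder u)"
  shows "t = u"
  using assms
proof (induction ts)
  case (Cons s ts)
  have "x \<notin> set (preorder s)" if "v \<in> set ts" "x \<in> set (preorder v)" for v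
    using Cons.prems(1) that by auto
  then show ?case
    using Cons by auto
qed simp

lemma distinct_forest_nodes_member:
  "distinct (forest_nodes ts) \<Longrightarrow> t \<in> set ts \<Longrightarrow> distinct (preorder t)"
  by (induction ts) auto

lemma sorted_forest_nodes_member:
  "sorted_wrt P (forest_nodes ts) \<Longrightarrow> t \<in> set ts \<Longrightarrow> sorted_wrt P (preorder t)"
  by (induction ts) (auto simp: sorted_wrt_append)

lemma forest_order_Field: "forest_order ts \<subseteq> set (forest_nodes ts) \<times> set (forest_nodes ts)"
  using tree_order_Field by (fastforce simp: forest_order_def)

lemma tree_order_RNode:
  "tree_order (RNode a ts) = {a} \<times> set (forest_nodes ts) \<union> forest_order ts"
  by (simp add: forest_order_def)

lemma forest_order_same_tree:
  assumes "distinct (forest_nodes ts)" "(x, y) \<in> forest_order ts"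
    and "t \<in> set ts" "x \<in> set (preorder t)" "u \<in> set ts" "y \<in> set (preorder u)"
  shows "t = u" "(x, y) \<in> tree_order t"
proof -
  obtain w where w: "w \<in> set ts" "(x, y) \<in> tree_order w"
    using assms(2) by (auto simp: forest_order_def)
  then have "x \<in> set (preorder w)" "y \<in> set (preorder w)"
    using tree_order_Field by blast+
  then have "t = w" "u = w"
    using forest_nodes_disjoint[OF assms(1)] w assms(3-) by metis+
  then show "t = u" "(x, y) \<in> tree_order t"
    using w by simp_all
qed

lemma trans_forest_orderI:
  assumes "distinct (forest_nodes ts)" "\<And>t. t \<in> set ts \<Longrightarrow> trans (tree_order t)"
  shows "trans (forest_order ts)"
proof (rule transI)
  fix x y z assume "(x, y) \<in> forest_order ts" "(y, z) \<in> forest_order ts"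
  then obtain t u where t: "t \<in> set ts" "(x, y) \<in> tree_order t"
    and u: "u \<in> set ts" "(y, z) \<in> tree_order u"
    by (auto simp: forest_order_def)
  moreover have "t = u"
    using forest_nodes_disjoint[OF assms(1) t(1) u(1), of y] t u tree_order_Field by blast
  ultimately have "(x, z) \<in> tree_order t"
    using assms(2)[OF t(1)] by (blast dest: transD)
  then show "(x, z) \<in> forest_order ts"
    using t by (auto simp: forest_order_def)
qed

lemma trans_tree_order: "distinct (preorder t) \<Longrightarrow> trans (tree_order t)"
proof (induction t)
  case (RNode a ts)
  then have "trans (forest_order ts)"
    by (intro trans_forest_orderI) (auto dest: distinct_forest_nodes_member)
  moreover have "a \<notin> set (forest_nodes ts)"
    using RNode.prems by simp
  ultimately show ?case
    unfolding tree_order_RNode trans_def using forest_order_Field by blast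
qed

lemma trans_forest_order: "distinct (forest_nodes ts) \<Longrightarrow> trans (forest_order ts)"
  by (simp add: trans_forest_orderI trans_tree_order distinct_forest_nodes_member)

text \<open>Edges are order pairs and the order is already transitive; conversely a descendant is
  reached from its ancestor by a path of edges.\<close>

lemma trancl_forest_edges:
  assumes "distinct (forest_nodes ts)"
  shows "(\<Union> (set (map tree_edges ts)))\<^sup>+ = forest_order ts"
proof
  have "\<Union> (set (map tree_edges ts)) \<subseteq> forest_order ts"
    using tree_edges_subset_order by (fastforce simp: forest_order_def)
  then have "(\<Union> (set (map tree_edges ts)))\<^sup>+ \<subseteq> (forest_order ts)\<^sup>+"
    by (rule trancl_mono_subset)
  then show "(\<Union> (set (map tree_edges ts)))\<^sup>+ \<subseteq> forest_order ts"
    by (simp add: trancl_id[OF trans_forest_order[OF assms]])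
  have "tree_order t \<subseteq> (\<Union> (set (map tree_edges ts)))\<^sup>+" if "t \<in> set ts" for t
  proof -
    have "(tree_edges t)\<^sup>+ \<subseteq> (\<Union> (set (map tree_edges ts)))\<^sup>+"
      by (rule trancl_mono_subset) (use that in auto)
    then show ?thesis using tree_order_subset_trancl[of t] by blast
  qed
  then show "forest_order ts \<subseteq> (\<Union> (set (map tree_edges ts)))\<^sup>+"
    by (auto simp: forest_order_def)
qed

text \<open>A preorder traversal lists every node before its descendants.\<close>

lemma tree_order_sorted:
  assumes "sorted_wrt (\<lambda>x y. lab x < (lab y :: nat)) (preorder t)" "(a, b) \<in> tree_order t"
  shows "lab a < lab b"
  using assms
proof (induction t)
  case (RNode c ts)
  then show ?case
    using sorted_forest_nodes_member by (auto simp: tree_order_RNode forest_order_def)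
qed

text \<open>Induction on the size of the interval between the two elements: if the pair is not a
  covering, any intermediate element splits it into two strictly smaller intervals.\<close>

lemma covers_trancl:
  assumes "finite A" "partial_order_on A r"
  shows "(covers r)\<^sup>+ = r - Id"
proof
  have tr: "trans r" and anti: "antisym r" and rA: "r \<subseteq> A \<times> A"
    using partial_order_onD[OF assms(2)] by auto
  have "(covers r)\<^sup>+ \<subseteq> (r - Id)\<^sup>+"
    by (rule trancl_mono_subset) (auto simp: covers_def)
  then show "(covers r)\<^sup>+ \<subseteq> r - Id"
    by (simp add: trancl_id[OF trans_diff_Id[OF tr anti]])
  have "(a, b) \<in> (covers r)\<^sup>+" if "(a, b) \<in> r - Id" for a b
    using that
  proof (induction "card {c. (a, c) \<in> r \<and> (c, b) \<in> r}" arbitrary: a b rule: less_induct)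
    case less
    show ?case
    proof (cases "(a, b) \<in> covers r")
      case False
      then obtain c where c: "(a, c) \<in> r" "(c, b) \<in> r" "c \<noteq> a" "c \<noteq> b"
        using less.prems by (auto simp: covers_def)
      let ?I = "\<lambda>a b. {c. (a, c) \<in> r \<and> (c, b) \<in> r}"
      have fin: "finite (?I a b)"
        by (rule finite_subset[OF _ assms(1)]) (use rA in auto)
      have refl: "(a, a) \<in> r" "(b, b) \<in> r"
        using partial_order_onD(1)[OF assms(2)] rA less.prems by (auto simp: refl_on_def)
      have "?I a c \<subset> ?I a b" "?I c b \<subset> ?I a b"
        using c refl tr anti by (auto dest: transD antisymD)
      then have "card (?I a c) < card (?I a b)" "card (?I c b) < card (?I a b)"
        using psubset_card_mono[OF fin] by blast+
      then have "(a, c) \<in> (covers r)\<^sup>+" "(c, b) \<in> (covers r)\<^sup>+"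
        using less.hyps c by auto
      then show ?thesis by simp
    qed simp
  qed
  then show "r - Id \<subseteq> (covers r)\<^sup>+" by auto
qed

text \<open>Meant for strict relations, hence the explicit inequality; for the reflexive order
  \<open>r\<close> the corresponding notion is the negation of \<open>comparable\<close>.\<close>

definition incomp :: "'a rel \<Rightarrow> 'a \<Rightarrow> 'a \<Rightarrow> bool" where
  "incomp R x y \<longleftrightarrow> x \<noteq> y \<and> (x, y) \<notin> R \<and> (y, x) \<notin> R"

definition thin :: "'a rel \<Rightarrow> bool" where
  "thin R \<longleftrightarrow> \<not> (\<exists>a b c d. (a, b) \<in> R \<and> (c, d) \<in> R \<and>
     incomp R a c \<and> incomp R a d \<and> incomp R b c \<and> incomp R b d)"

lemma length_preorder_gt_1:
  assumes "tree_order t \<noteq> {}"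
  shows "1 < length (preorder t)"
proof (cases t)
  case (RNode a ts)
  with assms obtain u where u: "u \<in> set ts"
    by (cases ts) auto
  then have "set (preorder u) \<subseteq> set (forest_nodes ts)" by auto
  then have "forest_nodes ts \<noteq> []" using root_in_preorder[of u] by force
  then show ?thesis using RNode by simp
qed

lemma tree_order_nonempty:
  assumes "1 < length (preorder t)"
  shows "tree_order t \<noteq> {}"
proof (cases t)
  case (RNode a ts)
  then have "forest_nodes ts \<noteq> []" using assms by auto
  then have "set (forest_nodes ts) \<noteq> {}" by (metis set_empty)
  then show ?thesis unfolding RNode tree_order_RNode by auto
qed

text \<open>Two distinct siblings cannot both have descendants, by thinness, and the one that has is
  visited last.\<close>

lemma forest_incomp_before:
  assumes thin: "thin R" and lab: "sorted_wrt (\<lambda>x y. lab x < (lab y :: nat)) (forest_nodes ts)"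
    and dist: "distinct (forest_nodes ts)" and last: "largest_last ts"
    and R: "forest_order ts = R \<inter> (set (forest_nodes ts) \<times> set (forest_nodes ts))"
    and IH: "\<And>t a b c. t \<in> set ts \<Longrightarrow> (a, b) \<in> tree_order t \<Longrightarrow> c \<in> set (preorder t) \<Longrightarrow>
      incomp R a c \<Longrightarrow> incomp R b c \<Longrightarrow> lab c < lab a"
    and ab: "(a, b) \<in> forest_order ts" and c: "c \<in> set (forest_nodes ts)"
    and inc: "incomp R a c" "incomp R b c"
  shows "lab c < lab a"
proof -
  obtain t where t: "t \<in> set ts" "(a, b) \<in> tree_order t"
    using ab by (auto simp: forest_order_def)
  then have abt: "a \<in> set (preorder t)" "b \<in> set (preorder t)"
    using tree_order_Field by blast+
  obtain u where u: "u \<in> set ts" "c \<in> set (preorder u)"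
    using c by auto
  show ?thesis
  proof (cases "u = t")
    case True
    then show ?thesis using IH t u inc by blast
  next
    case False
    have cross: "incomp R x y"
      if "v \<in> set ts" "v \<noteq> t" "x \<in> set (preorder t)" "y \<in> set (preorder v)" for x y v
    proof -
      have "x \<noteq> y" using forest_nodes_disjoint[OF dist t(1) that(1)] that by auto
      moreover have "(x, y) \<notin> forest_order ts" "(y, x) \<notin> forest_order ts"
        using forest_order_same_tree[OF dist] that t(1) by blast+
      ultimately show ?thesis
        using that t(1) by (auto simp: R incomp_def)
    qed
    \<comment> \<open>A related pair inside another tree would form, together with \<open>a\<close>
      and \<open>b\<close>, the configuration that thinness forbids.\<close>
    have small: "tree_order v = {}" if v: "v \<in> set ts" "v \<noteq> t" for v
    proof (rule ccontr)
      assume "tree_order v \<noteq> {}"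
      then obtain x y where xy: "(x, y) \<in> tree_order v" by auto
      then have "x \<in> set (preorder v)" "y \<in> set (preorder v)" using tree_order_Field by blast+
      then have "incomp R a x" "incomp R a y" "incomp R b x" "incomp R b y"
        using cross[OF v] abt by blast+
      moreover have "(a, b) \<in> R" "(x, y) \<in> R"
        using ab xy v R by (auto simp: forest_order_def)
      ultimately show False using thin unfolding thin_def by blast
    qed
    have "ts \<noteq> []" using t by auto
    then have lastin: "List.last ts \<in> set ts" by simp
    \<comment> \<open>The tree \<open>t\<close> contains the pair \<open>a\<close>,
      \<open>b\<close>, so the last tree, being at least as large, contains a related pair too. By
      \<open>small\<close> it must be \<open>t\<close> itself, and \<open>c\<close>, lying in
      another tree, is visited earlier.\<close>
    have "1 < length (preorder (List.last ts))"
      using length_preorder_gt_1[of t] t last \<open>ts \<noteq> []\<close> by (fastforce simp: largest_last_def)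
    then have "List.last ts = t"
      using small[OF lastin] tree_order_nonempty by blast
    then have ts: "ts = butlast ts @ [t]"
      using \<open>ts \<noteq> []\<close> by (metis append_butlast_last_id)
    have "set ts = set (butlast ts) \<union> {t}"
      by (subst ts) simp
    then have "u \<in> set (butlast ts)"
      using u False by simp
    moreover have "sorted_wrt (\<lambda>x y. lab x < lab y) (forest_nodes (butlast ts @ [t]))"
      using lab by (simp only: ts[symmetric])
    ultimately show ?thesis
      using u abt by (auto simp: sorted_wrt_append)
  qed
qed

text \<open>The root lies below all other nodes, so neither \<open>a\<close> nor \<open>c\<close>
  can be the root, and the claim concerns the forest of children. \<open>R\<close> is fixed globally
  and only its restriction is the order of the tree, so that thinness passes to subtrees.\<close>

lemma tree_incomp_before:
  assumes "thin R" "sorted_wrt (\<lambda>x y. lab x < (lab y :: nat)) (preorder t)"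
    and "distinct (preorder t)" "tree_largest_last t"
    and "tree_order t = R \<inter> (set (preorder t) \<times> set (preorder t))"
    and "(a, b) \<in> tree_order t" "c \<in> set (preorder t)" "incomp R a c" "incomp R b c"
  shows "lab c < lab a"
  using assms(2-)
proof (induction t arbitrary: a b c)
  case (RNode x ts)
  have x: "x \<notin> set (forest_nodes ts)"
    using RNode.prems by simp
  have FR: "forest_order ts = R \<inter> (set (forest_nodes ts) \<times> set (forest_nodes ts))"
  proof -
    have "forest_order ts = tree_order (RNode x ts) \<inter> (set (forest_nodes ts) \<times> set (forest_nodes ts))"
      using x forest_order_Field[of ts] unfolding tree_order_RNode by blast
    then show ?thesis
      unfolding RNode.prems(4) by auto
  qed
  have dist: "distinct (forest_nodes ts)"
    using RNode.prems by simp
  have root: "(x, y) \<in> R" if "y \<in> set (forest_nodes ts)" for y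
    using RNode.prems(4) that unfolding tree_order_RNode by auto
  have sub: "tree_order t = R \<inter> (set (preorder t) \<times> set (preorder t))" if t: "t \<in> set ts" for t
  proof
    show "tree_order t \<subseteq> R \<inter> (set (preorder t) \<times> set (preorder t))"
      using FR t tree_order_Field[of t] by (auto simp: forest_order_def)
    have "(y, z) \<in> tree_order t" if "(y, z) \<in> R" "y \<in> set (preorder t)" "z \<in> set (preorder t)" for y z
    proof -
      have "(y, z) \<in> forest_order ts" using FR that t by auto
      then show ?thesis
        by (rule forest_order_same_tree(2)[OF dist _ t _ t]) (use that in simp_all)
    qed
    then show "R \<inter> (set (preorder t) \<times> set (preorder t)) \<subseteq> tree_order t" by auto
  qed
  have c: "c \<in> set (forest_nodes ts)"
  proof (rule ccontr)
    assume "c \<notin> set (forest_nodes ts)"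
    then have "c = x" using RNode.prems by simp
    moreover have "b \<in> set (forest_nodes ts)"
      using RNode.prems(5) forest_order_Field unfolding tree_order_RNode by blast
    ultimately show False using RNode.prems(8) root by (auto simp: incomp_def)
  qed
  then have "a \<noteq> x"
    using RNode.prems(7) root by (auto simp: incomp_def)
  then have ab: "(a, b) \<in> forest_order ts"
    using RNode.prems(5) unfolding tree_order_RNode by auto
  show ?case
  proof (rule forest_incomp_before[OF assms(1) _ dist _ FR _ ab c RNode.prems(7,8)])
    fix t a b c
    assume t: "t \<in> set ts" "(a, b) \<in> tree_order t" "c \<in> set (preorder t)" "incomp R a c" "incomp R b c"
    show "lab c < lab a"
    proof (rule RNode.IH[OF t(1) _ _ _ sub[OF t(1)] t(2-)])
      show "sorted_wrt (\<lambda>x y. lab x < lab y) (preorder t)"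
        by (rule sorted_forest_nodes_member[OF _ t(1)]) (use RNode.prems(1) in simp)
    qed (use RNode.prems(3) t(1) distinct_forest_nodes_member[OF dist] in auto)
  qed (use RNode.prems in auto)
qed

text \<open>These facts are all that is used later of the planar drawing. The second combines
  thinness with the rule for siblings: an element incomparable to both ends of a chain is visited
  before the chain.\<close>

lemma standard_labeling_props:
  assumes thin: "thin_forest_poset A r" and lab: "standard_labeling A r lab"
  shows "(a, b) \<in> r \<Longrightarrow> a \<noteq> b \<Longrightarrow> lab a < lab b"
    and "(a, b) \<in> r \<Longrightarrow> a \<noteq> b \<Longrightarrow> c \<in> A \<Longrightarrow> \<not> comparable r a c \<Longrightarrow> \<not> comparable r b c \<Longrightarrow> lab c < lab a"
    and "inj_on lab A"
proof -
  have fin: "finite A" and po: "partial_order_on A r"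
    using thin by (auto simp: thin_forest_poset_def forest_poset_def)
  obtain ts where ts: "hasse_forest A r ts" "largest_last ts" "\<forall>t \<in> set ts. tree_largest_last t"
      "map lab (forest_nodes ts) = [1..<Suc (card A)]"
    using lab by (auto simp: standard_labeling_def)
  then have dist: "distinct (forest_nodes ts)" and A: "set (forest_nodes ts) = A"
    and edges: "\<Union> (set (map tree_edges ts)) = covers r"
    by (auto simp: hasse_forest_def)
  have order: "forest_order ts = r - Id"
    using trancl_forest_edges[OF dist] edges covers_trancl[OF fin po] by simp
  have "sorted_wrt (<) (map lab (forest_nodes ts))"
    unfolding ts(4) by (rule sorted_wrt_upt)
  then have sorted: "sorted_wrt (\<lambda>x y. lab x < lab y) (forest_nodes ts)"
    by (simp add: sorted_wrt_map)
  have "distinct (map lab (forest_nodes ts))"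
    unfolding ts(4) by simp
  then show "inj_on lab A"
    unfolding distinct_map A by simp
  { assume "(a, b) \<in> r" "a \<noteq> b"
    then have "(a, b) \<in> forest_order ts" by (simp add: order)
    then obtain t where "t \<in> set ts" "(a, b) \<in> tree_order t"
      by (auto simp: forest_order_def)
    then show "lab a < lab b"
      using tree_order_sorted[OF sorted_forest_nodes_member[OF sorted]] by blast }
  have refl: "(x, x) \<in> r" if "x \<in> A" for x
    using partial_order_onD(1)[OF po] that by (simp add: refl_on_def)
  have rA: "r \<subseteq> A \<times> A"
    using partial_order_onD(4)[OF po] .
  have incomp: "incomp (r - Id) x y \<longleftrightarrow> \<not> comparable r x y" if "x \<in> A" for x y
    using refl[OF that] by (auto simp: incomp_def comparable_def)
  have thin': "thin (r - Id)"
    unfolding thin_def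
  proof (intro notI, elim exE conjE)
    fix a b c d assume h: "(a, b) \<in> r - Id" "(c, d) \<in> r - Id" "incomp (r - Id) a c"
      "incomp (r - Id) a d" "incomp (r - Id) b c" "incomp (r - Id) b d"
    moreover have "a \<in> A" "b \<in> A" using h rA by auto
    ultimately show False
      using thin unfolding thin_forest_poset_def by (auto simp: incomp)
  qed
  have R: "forest_order ts = (r - Id) \<inter> (set (forest_nodes ts) \<times> set (forest_nodes ts))"
    using order forest_order_Field[of ts] by auto
  assume ab: "(a, b) \<in> r" "a \<noteq> b" and c: "c \<in> A" "\<not> comparable r a c" "\<not> comparable r b c"
  have sub: "tree_order t = (r - Id) \<inter> (set (preorder t) \<times> set (preorder t))" if t: "t \<in> set ts" for t
  proof
    show "tree_order t \<subseteq> (r - Id) \<inter> (set (preorder t) \<times> set (preorder t))"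
      using R t tree_order_Field[of t] by (auto simp: forest_order_def)
    have "(y, z) \<in> tree_order t"
      if "(y, z) \<in> r - Id" "y \<in> set (preorder t)" "z \<in> set (preorder t)" for y z
    proof -
      have "(y, z) \<in> forest_order ts" using order that by auto
      then show ?thesis
        by (rule forest_order_same_tree(2)[OF dist _ t _ t]) (use that in simp_all)
    qed
    then show "(r - Id) \<inter> (set (preorder t) \<times> set (preorder t)) \<subseteq> tree_order t" by auto
  qed
  show "lab c < lab a"
  proof (rule forest_incomp_before[OF thin' sorted dist ts(2) R])
    fix t a b c
    assume t: "t \<in> set ts" "(a, b) \<in> tree_order t" "c \<in> set (preorder t)"
      "incomp (r - Id) a c" "incomp (r - Id) b c"
    show "lab c < lab a"
      by (rule tree_incomp_before[OF thin' sorted_forest_nodes_member[OF sorted t(1)]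
            distinct_forest_nodes_member[OF dist t(1)] _ sub[OF t(1)] t(2-)])
        (use ts(3) t(1) in blast)
  next
    have "a \<in> A" "b \<in> A" using ab rA by auto
    then show "incomp (r - Id) a c" "incomp (r - Id) b c"
      using c by (simp_all add: incomp)
  qed (use ab c A order in simp_all)
qed

text \<open>By \<open>key\<close>, if two distinct comparable elements are both incomparable to a
  third, the third has the smallest label. If \<open>a\<close>, \<open>b\<close>, \<open>c\<close>
  is a chain of the dual with \<open>a\<close>, \<open>c\<close> comparable in \<open>r\<close>,
  then \<open>b\<close> would precede \<open>a\<close>; if \<open>a\<close>, \<open>b\<close> are
  both strictly below \<open>c\<close> in the dual and comparable in \<open>r\<close>, then
  \<open>c\<close> would precede both. These contradictions give transitivity and the forest
  property.\<close>

lemma dual_order_poset: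
  assumes thin: "thin_forest_poset A r" and lab: "standard_labeling A r lab"
  shows "partial_order_on A (dual_order A r lab)"
    and "(a, c) \<in> dual_order A r lab \<Longrightarrow> (b, c) \<in> dual_order A r lab \<Longrightarrow>
      comparable (dual_order A r lab) a b"
    and "a \<in> A \<Longrightarrow> b \<in> A \<Longrightarrow> a \<noteq> b \<Longrightarrow> comparable (dual_order A r lab) a b \<longleftrightarrow> \<not> comparable r a b"
proof -
  note props = standard_labeling_props[OF thin lab]
  have comm: "comparable r x y \<longleftrightarrow> comparable r y x" for x y
    by (auto simp: comparable_def)
  show *: "comparable (dual_order A r lab) a b \<longleftrightarrow> \<not> comparable r a b"
    if "a \<in> A" "b \<in> A" "a \<noteq> b" for a b
  proof -
    have "lab a \<noteq> lab b" using props(3) that by (auto dest: inj_onD)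
    then show ?thesis
      using that comm[of a b] unfolding comparable_def[of "dual_order A r lab"]
      by (auto simp: dual_order_def)
  qed
  have key: "lab c < lab a"
    if "a \<in> A" "b \<in> A" "c \<in> A" "comparable r a b" "a \<noteq> b" "lab a \<le> lab b"
      "\<not> comparable r a c" "\<not> comparable r b c" for a b c
  proof -
    have "(a, b) \<in> r"
      using that props(1)[of b a] by (auto simp: comparable_def)
    then show ?thesis using props(2) that by blast
  qed
  show "partial_order_on A (dual_order A r lab)"
    unfolding partial_order_on_def preorder_on_def
  proof (intro conjI)
    show "trans (dual_order A r lab)"
    proof (rule transI)
      fix a b c assume h: "(a, b) \<in> dual_order A r lab" "(b, c) \<in> dual_order A r lab"
      show "(a, c) \<in> dual_order A r lab"
      proof (cases "a = b \<or> b = c")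
        case False
        then have h': "a \<in> A" "b \<in> A" "c \<in> A" "\<not> comparable r a b" "\<not> comparable r b c"
          "lab a < lab b" "lab b < lab c"
          using h by (auto simp: dual_order_def)
        then have "a \<noteq> c" "\<not> comparable r c b"
          using comm[of b c] by auto
        then have "\<not> comparable r a c"
          using key[of a c b] h' by auto
        then show ?thesis using h' by (simp add: dual_order_def)
      qed (use h in auto)
    qed
  qed (auto simp: dual_order_def refl_on_def antisym_def)
  assume h: "(a, c) \<in> dual_order A r lab" "(b, c) \<in> dual_order A r lab"
  then have abc: "a \<in> A" "b \<in> A" "c \<in> A" by (auto simp: dual_order_def)
  show "comparable (dual_order A r lab) a b"
  proof (cases "a = b \<or> a = c \<or> b = c")
    case True
    then show ?thesis using h abc by (auto simp: comparable_def dual_order_def)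
  next
    case False
    then have h': "\<not> comparable r a c" "\<not> comparable r b c" "lab a < lab c" "lab b < lab c"
      using h by (auto simp: dual_order_def)
    have "\<not> comparable r a b"
    proof
      assume "comparable r a b"
      then show False
        using key[of a b c] key[of b a c] comm[of a b] h' abc False by force
    qed
    then show ?thesis using * abc False by simp
  qed
qed

section \<open>The change of basis and the relations\<close>

text \<open>Injectivity of the zeta transform: by induction all terms strictly below
  \<open>a\<close> vanish, which leaves \<open>g a\<close>.\<close>

lemma zeta_eq_0:
  fixes g :: "'a \<Rightarrow> 'b::ab_group_add"
  assumes "finite A" "partial_order_on A R"
    and zero: "\<And>a. a \<in> A \<Longrightarrow> (\<Sum>b | (b, a) \<in> R. g b) = 0" and "a \<in> A"
  shows "g a = 0"
proof -
  have RA: "R \<subseteq> A \<times> A" and refl: "refl_on A R"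
    using partial_order_onD[OF assms(2)] by auto
  have "wf (R - Id)"
    using assms finite_subset[OF RA] by (intro partial_order_on_well_order_on) auto
  then show ?thesis
    using \<open>a \<in> A\<close>
  proof (induction a rule: wf_induct_rule)
    case (less a)
    have "finite {b. (b, a) \<in> R}"
      by (rule finite_subset[OF _ assms(1)]) (use RA in auto)
    moreover have "a \<in> {b. (b, a) \<in> R}"
      using refl less.prems by (auto simp: refl_on_def)
    ultimately have "(\<Sum>b | (b, a) \<in> R. g b) = g a + (\<Sum>b\<in>{b. (b, a) \<in> R} - {a}. g b)"
      by (rule sum.remove)
    also have "(\<Sum>b\<in>{b. (b, a) \<in> R} - {a}. g b) = 0"
      by (rule sum.neutral) (use less RA in auto)
    finally show ?case using zero[OF less.prems] by simp
  qed
qed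

lemma zeta_surj:
  fixes v :: "'a \<Rightarrow> 'b::ab_group_add"
  assumes "finite A" "partial_order_on A R"
  obtains g where "\<And>a. a \<in> A \<Longrightarrow> (\<Sum>b | (b, a) \<in> R. g b) = v a"
proof -
  have RA: "R \<subseteq> A \<times> A" and refl: "refl_on A R"
    using partial_order_onD[OF assms(2)] by auto
  have "wf (R - Id)"
    using assms finite_subset[OF RA] by (intro partial_order_on_well_order_on) auto
  \<comment> \<open>Moebius inversion by well-founded recursion: the value at \<open>a\<close> is
    forced by the values strictly below \<open>a\<close>.\<close>
  then have "\<exists>g. \<forall>a. g a = v a - (\<Sum>b | (b, a) \<in> R - Id. g b)"
    by (rule dependent_wf_choice[where P = "\<lambda>g a x. x = v a - (\<Sum>b | (b, a) \<in> R - Id. g b)"]) auto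
  then obtain g where g: "\<And>a. g a = v a - (\<Sum>b | (b, a) \<in> R - Id. g b)"
    by blast
  have "(\<Sum>b | (b, a) \<in> R. g b) = v a" if "a \<in> A" for a
  proof -
    have "finite {b. (b, a) \<in> R}"
      by (rule finite_subset[OF _ assms(1)]) (use RA in auto)
    moreover have "a \<in> {b. (b, a) \<in> R}"
      using refl that by (auto simp: refl_on_def)
    ultimately have "(\<Sum>b | (b, a) \<in> R. g b) = g a + (\<Sum>b\<in>{b. (b, a) \<in> R} - {a}. g b)"
      by (rule sum.remove)
    also have "{b. (b, a) \<in> R} - {a} = {b. (b, a) \<in> R - Id}" by auto
    finally show ?thesis using g[of a] by simp
  qed
  then show ?thesis by (rule that)
qed

text \<open>Independence of the indexed family rather than of its set of values, so that it also
  excludes repetitions.\<close>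

definition lin_indep :: "'a set \<Rightarrow> ('a \<Rightarrow> ('g, 'k::field) tree_comb) \<Rightarrow> bool" where
  "lin_indep A v \<longleftrightarrow> (\<forall>g. (\<Sum>a\<in>A. tc_scale (g a) (v a)) = 0 \<longrightarrow> (\<forall>a\<in>A. g a = 0))"

text \<open>Exchanging the sums moves the summation from the vectors to the coefficients,
  transposed: vectors are summed upwards along \<open>R\<close>, coefficients downwards. Injectivity
  of the zeta transform then applies.\<close>

lemma lin_indep_zeta:
  assumes A: "finite A" "partial_order_on A R" and v: "lin_indep A v"
  shows "lin_indep A (\<lambda>b. \<Sum>a | (b, a) \<in> R. v a)"
  unfolding lin_indep_def
proof (intro allI impI ballI)
  fix g a assume g: "(\<Sum>b\<in>A. tc_scale (g b) (\<Sum>a | (b, a) \<in> R. v a)) = 0" and a: "a \<in> A"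
  have RA: "R \<subseteq> A \<times> A"
    using partial_order_onD[OF A(2)] by auto
  have eqs: "{a. (b, a) \<in> R} = {a. a \<in> A \<and> (b, a) \<in> R}" "{b. b \<in> A \<and> (b, a) \<in> R} = {b. (b, a) \<in> R}"
    for a b using RA by auto
  have "(\<Sum>b\<in>A. tc_scale (g b) (\<Sum>a | (b, a) \<in> R. v a)) =
      (\<Sum>b\<in>A. \<Sum>a | a \<in> A \<and> (b, a) \<in> R. tc_scale (g b) (v a))"
    by (simp only: tc.scale_sum_right eqs(1))
  also have "\<dots> = (\<Sum>a\<in>A. \<Sum>b | b \<in> A \<and> (b, a) \<in> R. tc_scale (g b) (v a))"
    by (rule sum.swap_restrict[OF A(1) A(1)])
  also have "\<dots> = (\<Sum>a\<in>A. tc_scale (\<Sum>b | (b, a) \<in> R. g b) (v a))"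
    by (simp only: tc.scale_sum_left eqs(2))
  finally have zero: "\<forall>a\<in>A. (\<Sum>b | (b, a) \<in> R. g b) = 0"
    using v[unfolded lin_indep_def, rule_format, of "\<lambda>a. \<Sum>b | (b, a) \<in> R. g b"] g by simp
  show "g a = 0"
    by (rule zeta_eq_0[where g = g, OF A _ a]) (use zero in blast)
qed

lemma corolla_inject [simp]: "corolla a = corolla b \<longleftrightarrow> a = b"
  by (simp add: corolla_def)

lemma lin_indep_gen: "finite A \<Longrightarrow> lin_indep A (gen :: 'a \<Rightarrow> ('a, 'k::field) tree_comb)"
  unfolding lin_indep_def
proof (intro allI impI ballI)
  fix g :: "'a \<Rightarrow> 'k" and a
  assume "finite A" and g: "(\<Sum>a\<in>A. tc_scale (g a) (gen a)) = 0" and a: "a \<in> A"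
  have "Poly_Mapping.lookup (\<Sum>b\<in>A. tc_scale (g b) (gen b)) (corolla a) = (\<Sum>b\<in>A. if b = a then g b else 0)"
    by (simp add: lookup_sum gen_def lookup_single when_def)
  then show "g a = 0"
    using g a \<open>finite A\<close> by simp
qed

lemma fspace_2_eq:
  assumes "finite A" "f \<in> fspace A 2"
  shows "f = (\<Sum>a\<in>A. tc_scale (Poly_Mapping.lookup f (corolla a)) (gen a))"
proof (rule poly_mapping_eqI)
  fix t
  show "Poly_Mapping.lookup f t =
      Poly_Mapping.lookup (\<Sum>a\<in>A. tc_scale (Poly_Mapping.lookup f (corolla a)) (gen a)) t"
  proof (cases "\<exists>a\<in>A. t = corolla a")
    case True
    then obtain a where a: "a \<in> A" "t = corolla a" by blast
    have "Poly_Mapping.lookup (\<Sum>b\<in>A. tc_scale (Poly_Mapping.lookup f (corolla b)) (gen b)) t =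
        (\<Sum>b\<in>A. if b = a then Poly_Mapping.lookup f (corolla b) else 0)"
      by (simp add: a lookup_sum gen_def lookup_single when_def)
    then show ?thesis using a assms(1) by simp
  next
    case False
    have "t \<notin> Poly_Mapping.keys f"
    proof
      assume "t \<in> Poly_Mapping.keys f"
      then have t: "size1 t = 2" "set_tree t \<subseteq> A" using assms(2) by (auto simp: fspace_iff)
      then obtain a where "t = corolla a" using size1_eq_2 by blast
      then show False using t False by (auto simp: corolla_def)
    qed
    moreover have "Poly_Mapping.lookup (\<Sum>b\<in>A. tc_scale (Poly_Mapping.lookup f (corolla b)) (gen b)) t =
        (\<Sum>b\<in>A. 0)"
      unfolding lookup_sum by (rule sum.cong) (use False in \<open>auto simp: gen_def lookup_single when_def\<close>)
    ultimately show ?thesis by (simp add: in_keys_iff)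
  qed
qed

text \<open>Abstracting from the composition lets one expansion serve \<open>tcomp i\<close>, the
  same with its arguments exchanged, and the difference of two compositions.\<close>

definition bil :: "(('g, 'k::field) tree_comb \<Rightarrow> ('g, 'k) tree_comb \<Rightarrow> ('g, 'k) tree_comb) \<Rightarrow> bool" where
  "bil \<beta> \<longleftrightarrow> (\<forall>y. tc_linear (\<lambda>x. \<beta> x y)) \<and> (\<forall>x. tc_linear (\<beta> x))"

lemma bil_tcomp: "bil (tcomp i)" and bil_tcomp_flip: "bil (\<lambda>x y. tcomp i y x)"
  by (auto simp: bil_def linear_tcomp_left linear_tcomp_right)

lemma bil_tcomp_diff: "bil (\<lambda>x y. tcomp i x y - tcomp j x y)"
  unfolding bil_def
  by (intro conjI allI tcl.linear_compose_sub linear_tcomp_left linear_tcomp_right)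

lemma
  assumes "bil \<beta>"
  shows bil_add_left: "\<beta> (x + x') y = \<beta> x y + \<beta> x' y" and bil_add_right: "\<beta> x (y + y') = \<beta> x y + \<beta> x y'"
    and bil_diff_right: "\<beta> x (y - y') = \<beta> x y - \<beta> x y'"
    and bil_sum_left: "\<beta> (sum u X) y = (\<Sum>c\<in>X. \<beta> (u c) y)" and bil_sum_right: "\<beta> x (sum u X) = (\<Sum>c\<in>X. \<beta> x (u c))"
  using assms unfolding bil_def
  by (simp_all add: tcl.linear_add[of "\<lambda>x. \<beta> x y"] tcl.linear_add[of "\<beta> x"]
    tcl.linear_diff[of "\<beta> x"]
    tcl.linear_sum[of "\<lambda>x. \<beta> x y"] tcl.linear_sum[of "\<beta> x"])

lemma bil_sum_mem:
  assumes "bil \<beta>" "tc.subspace V" "\<And>c d. c \<in> X \<Longrightarrow> d \<in> Y \<Longrightarrow> \<beta> (u c) (v d) \<in> V"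
  shows "\<beta> (sum u X) (sum v Y) \<in> V"
  unfolding bil_sum_left[OF assms(1)] bil_sum_right[OF assms(1)]
  by (intro tc.subspace_sum assms)

text \<open>What remains of the labeling: two forest orders on one set such that distinct elements
  are comparable in exactly one of them.\<close>

locale dual_forests =
  fixes A :: "'a set" and r s :: "'a rel"
  assumes finite_A: "finite A"
    and order_r: "partial_order_on A r" and order_s: "partial_order_on A s"
    and forest_r: "(a, c) \<in> r \<Longrightarrow> (b, c) \<in> r \<Longrightarrow> comparable r a b"
    and forest_s: "(a, c) \<in> s \<Longrightarrow> (b, c) \<in> s \<Longrightarrow> comparable s a b"
    and dual: "a \<in> A \<Longrightarrow> b \<in> A \<Longrightarrow> a \<noteq> b \<Longrightarrow> comparable s a b \<longleftrightarrow> \<not> comparable r a b"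
begin

lemma r_sub: "r \<subseteq> A \<times> A" and s_sub: "s \<subseteq> A \<times> A"
  and trans_r: "(a, b) \<in> r \<Longrightarrow> (b, c) \<in> r \<Longrightarrow> (a, c) \<in> r"
  and trans_s: "(a, b) \<in> s \<Longrightarrow> (b, c) \<in> s \<Longrightarrow> (a, c) \<in> s"
  and antisym_s: "(a, b) \<in> s \<Longrightarrow> (b, a) \<in> s \<Longrightarrow> a = b"
  and refl_r: "a \<in> A \<Longrightarrow> (a, a) \<in> r" and refl_s: "a \<in> A \<Longrightarrow> (a, a) \<in> s"
  using partial_order_onD[OF order_r] partial_order_onD[OF order_s]
  by (blast dest: transD antisymD refl_onD)+

lemma comparable_commute: "comparable R a b \<longleftrightarrow> comparable R b a"
  by (auto simp: comparable_def)

lemma finite_r: "finite {c. (a, c) \<in> r}"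
  and finite_s: "finite {c. (c, a) \<in> s}"
  by (rule finite_subset[OF _ finite_A], use r_sub s_sub in blast)+

lemma up_r_induct [consumes 1, case_names step]:
  assumes "a \<in> A" "\<And>a. a \<in> A \<Longrightarrow> (\<And>c. (a, c) \<in> r \<Longrightarrow> c \<noteq> a \<Longrightarrow> P c) \<Longrightarrow> P a"
  shows "P a"
proof -
  have "wf (r\<inverse> - Id)"
    using order_r r_sub finite_A by (intro partial_order_on_well_order_on[of _ A]) (auto intro: finite_subset)
  then show ?thesis
    using assms(1)
  proof (induction a rule: wf_induct_rule)
    case (less a)
    show ?case by (rule assms(2)[OF less.prems]) (use less.IH r_sub in auto)
  qed
qed

lemma down_s_induct [consumes 1, case_names step]:
  assumes "a \<in> A" "\<And>a. a \<in> A \<Longrightarrow> (\<And>c. (c, a) \<in> s \<Longrightarrow> c \<noteq> a \<Longrightarrow> P c) \<Longrightarrow> P a"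
  shows "P a"
proof -
  have "wf (s - Id)"
    using order_s s_sub finite_A by (intro partial_order_on_well_order_on[of _ A]) (auto intro: finite_subset)
  then show ?thesis
    using assms(1)
  proof (induction a rule: wf_induct_rule)
    case (less a)
    show ?case by (rule assms(2)[OF less.prems]) (use less.IH s_sub in auto)
  qed
qed

text \<open>If \<open>c\<close> were below \<open>d\<close>, then \<open>a\<close> and
  \<open>b\<close> would both lie below \<open>d\<close>, hence be comparable in a forest; the other
  case is symmetric.\<close>

lemma incomparable_up:
  assumes "a \<in> A" "b \<in> A" "\<not> comparable r a b" "(a, c) \<in> r" "(b, d) \<in> r"
  shows "\<not> comparable r c d"
proof
  have *: "comparable r x y" if "(x, z) \<in> r" "(y, w) \<in> r" "(z, w) \<in> r" for x y z w
    using forest_r[of x w y] trans_r that by blast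
  assume "comparable r c d"
  then show False
    using *[of a c b d] *[of b d a c] assms comparable_commute[of r a b] by (auto simp: comparable_def[of r c d])
qed

lemma comparable_s_incomparable_r: "comparable s a b \<Longrightarrow> a \<noteq> b \<Longrightarrow> \<not> comparable r a b"
  using dual[of a b] s_sub by (auto simp: comparable_def[of s])

section \<open>The unitriangular changes of basis\<close>

definition S :: "'a \<Rightarrow> ('a, 'k::field) tree_comb" where
  "S a = (\<Sum>c | (a, c) \<in> r. gen c)"

definition B :: "'a \<Rightarrow> ('a, 'k::field) tree_comb" where
  "B b = (\<Sum>a | (a, b) \<in> s. S a)"

lemma S_fspace: "a \<in> A \<Longrightarrow> S a \<in> fspace A 2"
  unfolding S_def using r_sub by (intro tc.subspace_sum[OF subspace_fspace] gen_fspace) auto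

lemma B_fspace: "b \<in> A \<Longrightarrow> B b \<in> fspace A 2"
  unfolding B_def using s_sub by (intro tc.subspace_sum[OF subspace_fspace] S_fspace) auto

lemma gen_eq_S: "a \<in> A \<Longrightarrow> gen a = S a - (\<Sum>c\<in>{c. (a, c) \<in> r} - {a}. gen c)"
  by (simp add: S_def sum_diff1 finite_r refl_r)

lemma S_eq_B: "b \<in> A \<Longrightarrow> S b = B b - (\<Sum>a\<in>{a. (a, b) \<in> s} - {b}. S a)"
  by (simp add: B_def sum_diff1 finite_s refl_s)

text \<open>Unitriangular inversion without explicit coefficients. The subspace is arbitrary so that
  it may consist of the elements whose composite with a fixed one lies in a given subspace;
  \<open>S_mem_subspace\<close> is the analogue for the other change of basis.\<close>

lemma gen_mem_subspace:
  assumes "tc.subspace W" "a \<in> A" "\<And>c. (a, c) \<in> r \<Longrightarrow> S c \<in> W"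
  shows "gen a \<in> W"
  using assms(2,3)
proof (induction a rule: up_r_induct)
  case (step a)
  have "gen c \<in> W" if "c \<in> {c. (a, c) \<in> r} - {a}" for c
    using that step trans_r by blast
  then have "(\<Sum>c\<in>{c. (a, c) \<in> r} - {a}. gen c) \<in> W"
    by (rule tc.subspace_sum[OF assms(1)])
  then show ?case
    unfolding gen_eq_S[OF step.hyps] using step refl_r by (intro tc.subspace_diff[OF assms(1)]) auto
qed

lemma S_mem_subspace:
  assumes "tc.subspace W" "b \<in> A" "\<And>a. (a, b) \<in> s \<Longrightarrow> B a \<in> W"
  shows "S b \<in> W"
  using assms(2,3)
proof (induction b rule: down_s_induct)
  case (step b)
  have "S c \<in> W" if "c \<in> {c. (c, b) \<in> s} - {b}" for c
    using that step trans_s by blast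
  then have "(\<Sum>c\<in>{c. (c, b) \<in> s} - {b}. S c) \<in> W"
    by (rule tc.subspace_sum[OF assms(1)])
  then show ?case
    unfolding S_eq_B[OF step.hyps] using step refl_s by (intro tc.subspace_diff[OF assms(1)]) auto
qed

lemma lin_indep_B: "lin_indep A (B :: 'a \<Rightarrow> ('a, 'k::field) tree_comb)"
proof -
  have "lin_indep A (S :: 'a \<Rightarrow> ('a, 'k) tree_comb)"
    using lin_indep_zeta[OF finite_A order_r lin_indep_gen[OF finite_A]] by (simp add: S_def[abs_def])
  moreover have "partial_order_on A (s\<inverse>)"
    using order_s by simp
  ultimately show ?thesis
    using lin_indep_zeta[OF finite_A, of "s\<inverse>" S] by (simp add: B_def[abs_def])
qed

lemma lift_B_inj:
  assumes "f \<in> fspace A 2" "g \<in> fspace A 2" "lift B f = lift B (g :: ('a, 'k::field) tree_comb)"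
  shows "f = g"
proof -
  let ?d = "f - g"
  have d: "?d \<in> fspace A 2"
    using assms tc.subspace_diff[OF subspace_fspace] by blast
  have "0 = lift B ?d"
    using assms(3) by (simp add: tcl.linear_diff[OF linear_lin])
  also have "\<dots> = (\<Sum>a\<in>A. tc_scale (Poly_Mapping.lookup ?d (corolla a)) (B a))"
    by (subst fspace_2_eq[OF finite_A d])
      (simp add: tcl.linear_sum[OF linear_lin] lin_scale lift_gen[where h = B, OF B_fspace])
  finally have "Poly_Mapping.lookup ?d (corolla a) = 0" if "a \<in> A" for a
    using lin_indep_B that unfolding lin_indep_def by metis
  then have "?d = 0"
    by (subst fspace_2_eq[OF finite_A d]) simp
  then show ?thesis by simp
qed

text \<open>By triangularity each generator has a preimage of arity 2 under the lift. Chosen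
  preimages \<open>h\<close> give a one-sided inverse on generators; injectivity in arity 2 makes it
  two-sided.\<close>

lemma operad_iso_lift_B:
  "operad_iso (free_operad A :: ('k::field, _) ns_operad) (free_operad A) (\<lambda>n. lift B)"
proof -
  let ?W = "lift B ` (fspace A 2 :: ('a, 'k) tree_comb set)"
  have W: "tc.subspace ?W"
    by (rule tcl.linear_subspace_image[OF linear_lin subspace_fspace])
  have BW: "B b \<in> ?W" if "b \<in> A" for b
    by (rule image_eqI[where f = "lift B" and x = "gen b"])
      (simp_all add: lift_gen[where h = B, OF B_fspace[OF that]] gen_fspace that)
  have "S b \<in> ?W" if "b \<in> A" for b
    by (rule S_mem_subspace[OF W that]) (use BW s_sub in blast)
  then have "gen a \<in> ?W" if "a \<in> A" for a
    by (intro gen_mem_subspace[OF W that]) (use r_sub in blast)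
  then have "\<forall>a\<in>A. \<exists>f. f \<in> fspace A 2 \<and> lift B f = (gen a :: ('a, 'k) tree_comb)"
    by (metis imageE)
  then obtain h where h: "\<And>a. a \<in> A \<Longrightarrow> h a \<in> fspace A 2"
      "\<And>a. a \<in> A \<Longrightarrow> lift B (h a) = (gen a :: ('a, 'k) tree_comb)"
    by metis
  have inv: "lift h (B a) = gen a" if a: "a \<in> A" for a
  proof (rule lift_B_inj)
    show "lift h (B a) \<in> fspace A 2"
      by (rule lift_fspace[OF h(1) B_fspace[OF a]])
    show "lift B (lift h (B a)) = lift B (gen a)"
      using lift_lift[where h = B and h' = h, OF B_fspace h B_fspace[OF a]]
      by (simp add: lift_gen[where h = B, OF B_fspace[OF a]])
  qed (rule gen_fspace[OF a])
  show ?thesis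
    by (rule operad_iso_lift[where h = B and h' = h]) (simp_all add: B_fspace h inv)
qed

text \<open>In the forest \<open>s\<close>, every element below \<open>b\<close> is comparable to
  \<open>a\<close>, so one that is not below \<open>a\<close> lies strictly above it.\<close>

lemma B_diff:
  assumes "(a, b) \<in> s"
  shows "B b - B a = (\<Sum>c | (a, c) \<in> s \<and> c \<noteq> a \<and> (c, b) \<in> s. S c)"
proof -
  let ?X = "{c. (a, c) \<in> s \<and> c \<noteq> a \<and> (c, b) \<in> s}"
  have "{c. (c, b) \<in> s} = {c. (c, a) \<in> s} \<union> ?X"
  proof
    show "{c. (c, b) \<in> s} \<subseteq> {c. (c, a) \<in> s} \<union> ?X"
      using forest_s[OF assms] refl_s s_sub by (auto simp: comparable_def)
    show "{c. (c, a) \<in> s} \<union> ?X \<subseteq> {c. (c, b) \<in> s}"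
      using trans_s assms by blast
  qed
  moreover have "{c. (c, a) \<in> s} \<inter> ?X = {}"
    using antisym_s by blast
  moreover have "finite ?X"
    by (rule finite_subset[OF _ finite_s[of b]]) auto
  ultimately show ?thesis
    unfolding B_def using finite_s by (simp add: sum.union_disjoint)
qed

text \<open>\<open>rels V\<close> says that, modulo \<open>V\<close>, the elements \<open>B b\<close> satisfy the relations
  of the operad of \<open>s\<close>.\<close>

definition rels :: "('a, 'k::field) tree_comb set \<Rightarrow> bool" where
  "rels V \<longleftrightarrow> (\<forall>i\<in>{1, 2}. \<forall>a b. (a, b) \<in> s \<longrightarrow>
       tcomp i (B a) (B b) - tcomp i (B a) (B a) \<in> V \<and> tcomp i (B b) (B a) - tcomp i (B a) (B a) \<in> V) \<and>
     (\<forall>a\<in>A. tcomp 1 (B a) (B a) - tcomp 2 (B a) (B a) \<in> V)"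

text \<open>With \<open>B a\<close> kept on the left, \<open>B b - B a\<close> is the sum of the
  \<open>S c\<close> with \<open>c\<close> above \<open>a\<close> up to \<open>b\<close>; all terms
  except \<open>S b\<close> are known by induction, so \<open>S b\<close> can be isolated.\<close>

lemma bil_S_S_mem:
  fixes \<beta> :: "('a, 'k::field) tree_comb \<Rightarrow> ('a, 'k) tree_comb \<Rightarrow> ('a, 'k) tree_comb"
  assumes \<beta>: "bil \<beta>" and V: "tc.subspace V"
    and H: "\<And>a b. (a, b) \<in> s \<Longrightarrow> \<beta> (B a) (B b) - \<beta> (B a) (B a) \<in> V"
    and ab: "(a, b) \<in> s" "a \<noteq> b"
  shows "\<beta> (S a) (S b) \<in> V"
proof -
  have BS: "\<beta> (B a) (S b) \<in> V" if "(a, b) \<in> s" "a \<noteq> b" for a b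
  proof -
    have "b \<in> A" using that s_sub by auto
    then show ?thesis
      using that
    proof (induction b rule: down_s_induct)
      case (step b)
      let ?X = "{c. (a, c) \<in> s \<and> c \<noteq> a \<and> (c, b) \<in> s}"
      have "finite ?X"
        by (rule finite_subset[OF _ finite_s[of b]]) auto
      moreover have "b \<in> ?X"
        using step refl_s by auto
      ultimately have "B b - B a - (\<Sum>c\<in>?X - {b}. S c) = (S b :: ('a, 'k) tree_comb)"
        unfolding B_diff[OF step.prems(1)] by (simp add: sum_diff1)
      moreover have "\<beta> (B a) (\<Sum>c\<in>?X - {b}. S c) \<in> V"
        unfolding bil_sum_right[OF \<beta>] by (intro tc.subspace_sum[OF V]) (use step in blast)
      then have "\<beta> (B a) (B b - B a - (\<Sum>c\<in>?X - {b}. S c)) \<in> V"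
        using tc.subspace_diff[OF V H[OF step.prems(1)]] by (simp add: bil_diff_right[OF \<beta>])
      ultimately show ?case by simp
    qed
  qed
  \<comment> \<open>The left argument is inverted last: \<open>b\<close> is strictly above every
    \<open>c\<close> below \<open>a\<close>, so \<open>BS\<close> covers all the \<open>B c\<close>
    from which \<open>S a\<close> is built.\<close>
  let ?W = "{x. \<beta> x (S b) \<in> V}"
  have "tc.subspace ?W"
    using tcl.linear_subspace_vimage[of "\<lambda>x. \<beta> x (S b)" V] \<beta> V by (simp add: bil_def vimage_def)
  moreover have "B c \<in> ?W" if "(c, a) \<in> s" for c
    using BS[of c b] trans_s[OF that ab(1)] antisym_s that ab by blast
  ultimately show ?thesis
    using S_mem_subspace[of ?W a] ab s_sub by blast
qed

lemma rels_S_S: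
  assumes V: "tc.subspace V" and rels: "rels V" and i: "i \<in> {1, 2}"
    and ab: "a \<in> A" "b \<in> A" "\<not> comparable r a b"
  shows "tcomp i (S a) (S b) \<in> V"
proof -
  have ne: "a \<noteq> b" using ab refl_r by (auto simp: comparable_def)
  then have "comparable s a b" using dual ab by blast
  then consider "(a, b) \<in> s" | "(b, a) \<in> s" by (auto simp: comparable_def)
  then show ?thesis
  proof cases
    case 1
    show ?thesis
      by (rule bil_S_S_mem[OF bil_tcomp V _ 1 ne]) (use rels i in \<open>auto simp: rels_def\<close>)
  next
    case 2
    show ?thesis
      by (rule bil_S_S_mem[OF bil_tcomp_flip V _ 2 ne[symmetric]]) (use rels i in \<open>auto simp: rels_def\<close>)
  qed
qed

text \<open>Split \<open>B m\<close> as \<open>S m\<close> plus the terms strictly below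
  \<open>m\<close> and expand. Mixed products vanish modulo \<open>V\<close> because distinct
  elements below \<open>m\<close> in the forest \<open>s\<close> are incomparable in
  \<open>r\<close>; the equal ones below \<open>m\<close> are covered by induction.\<close>

lemma rels_S_diff:
  fixes V :: "('a, 'k::field) tree_comb set"
  assumes V: "tc.subspace V" and rels: "rels V" and m: "m \<in> A"
  shows "tcomp 1 (S m) (S m) - tcomp 2 (S m) (S m) \<in> V"
  using m
proof (induction m rule: down_s_induct)
  case (step m)
  define D where "D x y = tcomp 1 x y - tcomp 2 x y" for x y :: "('a, 'k) tree_comb"
  have D: "bil D"
    unfolding D_def[abs_def] by (rule bil_tcomp_diff)
  have cross: "D (S c) (S d) \<in> V" if "(c, m) \<in> s" "(d, m) \<in> s" "c \<noteq> d" for c d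
  proof -
    have "c \<in> A" "d \<in> A" "\<not> comparable r c d"
      using that s_sub forest_s[OF that(1,2)] comparable_s_incomparable_r by auto
    then show ?thesis
      unfolding D_def by (intro tc.subspace_diff[OF V] rels_S_S[OF V rels]) auto
  qed
  let ?X = "{c. (c, m) \<in> s} - {m}"
  let ?T = "\<Sum>c\<in>?X. S c :: ('a, 'k) tree_comb"
  have mm: "(m, m) \<in> s" using step refl_s by blast
  have "D (B m) (B m) \<in> V"
    using rels step by (simp add: rels_def D_def)
  moreover have "D ?T (S m) \<in> V"
    unfolding bil_sum_left[OF D] by (intro tc.subspace_sum[OF V] cross) (use mm in auto)
  moreover have "D (S m) ?T \<in> V"
    unfolding bil_sum_right[OF D] by (intro tc.subspace_sum[OF V] cross) (use mm in auto)
  moreover have "D ?T ?T \<in> V"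
  proof (rule bil_sum_mem[OF D V])
    fix c d assume "c \<in> ?X" "d \<in> ?X"
    then show "D (S c) (S d) \<in> V"
      using step.IH[of c] cross[of c d] by (cases "c = d") (auto simp: D_def)
  qed
  moreover have "B m = S m + ?T"
    by (simp add: S_eq_B[OF step.hyps])
  then have "D (B m) (B m) = D (S m + ?T) (S m + ?T)" by simp
  then have "D (B m) (B m) = D (S m) (S m) + D ?T (S m) + D (S m) ?T + D ?T ?T"
    by (simp add: bil_add_left[OF D] bil_add_right[OF D] add.assoc)
  then have "D (S m) (S m) = D (B m) (B m) - D ?T (S m) - D (S m) ?T - D ?T ?T"
    by simp
  ultimately have "D (S m) (S m) \<in> V"
    using tc.subspace_diff[OF V] by presburger
  then show ?case by (simp add: D_def)
qed

text \<open>Inverting \<open>S\<close> on both sides only brings in \<open>S c\<close> and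
  \<open>S d\<close> with \<open>c\<close> above \<open>a\<close> and \<open>d\<close> above
  \<open>b\<close>, and such pairs stay incomparable.\<close>

lemma rels_gen_gen:
  assumes V: "tc.subspace V" and rels: "rels V" and i: "i \<in> {1, 2}"
    and ab: "a \<in> A" "b \<in> A" "\<not> comparable r a b"
  shows "tcomp i (gen a) (gen b) \<in> V"
proof -
  have sub: "tc.subspace {x. tcomp i x y \<in> V}" "tc.subspace {y. tcomp i x y \<in> V}" for x y
    using tcl.linear_subspace_vimage[OF linear_tcomp_left V, of i y]
      tcl.linear_subspace_vimage[OF linear_tcomp_right V, of i x] by (simp_all add: vimage_def)
  have "tcomp i (gen a) (S d) \<in> V" if "(b, d) \<in> r" for d
  proof -
    have "tcomp i (S c) (S d) \<in> V" if "(a, c) \<in> r" for c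
      using incomparable_up[OF ab that \<open>(b, d) \<in> r\<close>] that \<open>(b, d) \<in> r\<close> r_sub
      by (intro rels_S_S[OF V rels i]) auto
    then show ?thesis
      using gen_mem_subspace[OF sub(1) ab(1)] by blast
  qed
  then show ?thesis
    using gen_mem_subspace[OF sub(2) ab(2)] by blast
qed

end

section \<open>The Koszul dual in coordinates\<close>

lemma graft_corolla:
  "graft (Suc 0) (corolla a) (corolla b) = Node (Node Leaf b Leaf) a Leaf"
  "graft 2 (corolla a) (corolla b) = Node Leaf a (Node Leaf b Leaf)"
  by (simp_all add: corolla_def)

lemma size1_eq_3:
  assumes "size1 t = 3"
  obtains a b where "t = graft 1 (corolla a) (corolla b)" | a b where "t = graft 2 (corolla a) (corolla b)"
proof -
  have leaf: "size1 t = 1 \<Longrightarrow> t = Leaf" for t :: "'a tree"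
    by (cases t) (auto simp: size1_size)
  obtain l c r where t: "t = Node l c r" "size1 l + size1 r = 3"
    using assms by (cases t) auto
  have "0 < size1 l" "0 < size1 r" by simp_all
  then consider "size1 l = 1" "size1 r = 2" | "size1 l = 2" "size1 r = 1"
    using t(2) by linarith
  then show ?thesis
  proof cases
    case 1
    then obtain b where "r = corolla b" using size1_eq_2 by blast
    then show ?thesis using that(2)[of c b] leaf[of l] 1 t by (simp add: graft_corolla) (simp add: corolla_def)
  next
    case 2
    then obtain b where "l = corolla b" using size1_eq_2 by blast
    then show ?thesis using that(1)[of c b] leaf[of r] 2 t by (simp add: graft_corolla) (simp add: corolla_def)
  qed
qed

text \<open>The form is diagonal on trees, hence a linear functional of \<open>g\<close>. Scalars
  are represented as multiples of \<open>Leaf\<close>, so that the lemmas on \<open>lin\<close>,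
  whose values are tree combinations, apply.\<close>

lemma koszul_form_lin:
  fixes f :: "('g, 'k::field) tree_comb"
  shows "koszul_form f g = Poly_Mapping.lookup (lin (\<lambda>t.
     Poly_Mapping.single (Leaf :: 'g tree) (Poly_Mapping.lookup f t * koszul_form_basis t t)) g) Leaf"
proof -
  have "koszul_form f g = (\<Sum>t'\<in>Poly_Mapping.keys g. \<Sum>t\<in>Poly_Mapping.keys f.
      Poly_Mapping.lookup f t * Poly_Mapping.lookup g t' * koszul_form_basis t t')"
    unfolding koszul_form_def by (rule sum.swap)
  also have "\<dots> = (\<Sum>t'\<in>Poly_Mapping.keys g. \<Sum>t\<in>Poly_Mapping.keys f.
      if t = t' then Poly_Mapping.lookup g t' * (Poly_Mapping.lookup f t' * koszul_form_basis t' t') else 0)"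
    by (intro sum.cong refl) (auto simp: koszul_form_basis_def)
  also have "\<dots> = (\<Sum>t'\<in>Poly_Mapping.keys g.
      Poly_Mapping.lookup g t' * (Poly_Mapping.lookup f t' * koszul_form_basis t' t'))"
    by (intro sum.cong refl) (auto simp: in_keys_iff)
  finally show ?thesis
    by (simp add: lin_def lookup_sum)
qed

lemma koszul_form_diff: "koszul_form f (g - g') = koszul_form f g - koszul_form f g'"
  by (simp add: koszul_form_lin tcl.linear_diff[OF linear_lin] lookup_minus)

lemma subspace_koszul_annihilated: "tc.subspace {g. koszul_form f g = 0}"
  by (intro tc.subspaceI)
    (simp_all add: koszul_form_lin lin_add lin_scale lookup_add lookup_tc_scale tcl.linear_0[OF linear_lin])

lemma koszul_form_gen_comp:
  "koszul_form f (gen_comp a 1 b) = Poly_Mapping.lookup f (graft 1 (corolla a) (corolla b))"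
  "koszul_form f (gen_comp a 2 b) = - Poly_Mapping.lookup f (graft 2 (corolla a) (corolla b))"
  by (simp_all add: koszul_form_lin gen_comp_def koszul_form_basis_def graft_corolla)

lemma gen_comp_tcomp: "gen_comp a i b = tcomp i (gen a) (gen b)"
  by (simp add: gen_comp_def gen_def)

context dual_forests
begin

text \<open>The annihilator conditions written out on coefficients; the minus signs come from the
  sign of the form on \<open>x \<circ>\<^sub>2 y\<close>.\<close>

definition coeffs_balanced :: "('a, 'k::field) tree_comb \<Rightarrow> bool" where
  "coeffs_balanced f \<longleftrightarrow> (\<forall>a\<in>A. \<forall>b\<in>A. comparable r a b \<longrightarrow>
     Poly_Mapping.lookup f (graft 1 (corolla a) (corolla b)) =
       - Poly_Mapping.lookup f (graft 2 (corolla (poset_min r a b)) (corolla (poset_min r a b))) \<and>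
     Poly_Mapping.lookup f (graft 2 (corolla a) (corolla b)) =
       - Poly_Mapping.lookup f (graft 1 (corolla (poset_min r a b)) (corolla (poset_min r a b))))"

lemma koszul_dual_As:
  "snd (koszul_dual (As_presentation A r)) = {f \<in> fspace A 3. coeffs_balanced (f :: ('a, 'k::field) tree_comb)}"
proof -
  have "(\<forall>g\<in>tc.span (As_relators A r). koszul_form f g = 0) \<longleftrightarrow> coeffs_balanced f"
    for f :: "('a, 'k) tree_comb"
  proof -
    \<comment> \<open>The elements orthogonal to \<open>f\<close> form a subspace, so testing on the
      relators suffices.\<close>
    have "(\<forall>g\<in>tc.span (As_relators A r). koszul_form f g = 0) \<longleftrightarrow> (\<forall>g\<in>As_relators A r. koszul_form f g = 0)"
      using tc.span_minimal[OF _ subspace_koszul_annihilated[of f], of "As_relators A r"] tc.span_superset[of "As_relators A r"]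
      by blast
    also have "\<dots> \<longleftrightarrow> coeffs_balanced f"
    proof
      assume H: "\<forall>g\<in>As_relators A r. koszul_form f g = 0"
      show "coeffs_balanced f"
        unfolding coeffs_balanced_def
      proof (intro ballI impI)
        fix a b assume ab: "a \<in> A" "b \<in> A" "comparable r a b"
        let ?m = "poset_min r a b"
        have "gen_comp a 1 b - gen_comp ?m 2 ?m \<in> (As_relators A r :: ('a, 'k) tree_comb set)"
          "gen_comp ?m 1 ?m - gen_comp a 2 b \<in> (As_relators A r :: ('a, 'k) tree_comb set)"
          using ab unfolding As_relators_def by blast+
        then have "koszul_form f (gen_comp a 1 b - gen_comp ?m 2 ?m) = 0"
          "koszul_form f (gen_comp ?m 1 ?m - gen_comp a 2 b) = 0"
          using H by blast+
        then show "Poly_Mapping.lookup f (graft 1 (corolla a) (corolla b)) =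
            - Poly_Mapping.lookup f (graft 2 (corolla ?m) (corolla ?m)) \<and>
          Poly_Mapping.lookup f (graft 2 (corolla a) (corolla b)) =
            - Poly_Mapping.lookup f (graft 1 (corolla ?m) (corolla ?m))"
          unfolding koszul_form_diff koszul_form_gen_comp
          by (simp add: eq_neg_iff_add_eq_0 add.commute)
      qed
    next
      assume H: "coeffs_balanced f"
      show "\<forall>g\<in>As_relators A r. koszul_form f g = 0"
      proof
        fix g :: "('a, 'k) tree_comb" assume "g \<in> As_relators A r"
        then obtain a b where "a \<in> A" "b \<in> A" "comparable r a b" and
          "g = gen_comp a 1 b - gen_comp (poset_min r a b) 2 (poset_min r a b) \<or>
           g = gen_comp (poset_min r a b) 1 (poset_min r a b) - gen_comp a 2 b"
          unfolding As_relators_def by blast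
        then show "koszul_form f g = 0"
          using H unfolding coeffs_balanced_def
          by (elim disjE) (simp_all only: koszul_form_diff koszul_form_gen_comp, simp_all)
      qed
    qed
    finally show ?thesis .
  qed
  then show ?thesis
    by (simp add: koszul_dual_def As_presentation_def)
qed

lemma subspace_coeffs_balanced: "tc.subspace {f \<in> fspace A 3. coeffs_balanced f}"
proof (rule tc.subspaceI)
  show "0 \<in> {f \<in> fspace A 3. coeffs_balanced f}"
    by (simp add: coeffs_balanced_def tc.subspace_0[OF subspace_fspace])
next
  fix f g :: "('a, 'b) tree_comb"
  assume "f \<in> {f \<in> fspace A 3. coeffs_balanced f}" "g \<in> {f \<in> fspace A 3. coeffs_balanced f}"
  then show "f + g \<in> {f \<in> fspace A 3. coeffs_balanced f}"
    by (simp add: coeffs_balanced_def lookup_add tc.subspace_add[OF subspace_fspace])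
next
  fix c and f :: "('a, 'b) tree_comb"
  assume "f \<in> {f \<in> fspace A 3. coeffs_balanced f}"
  then show "tc_scale c f \<in> {f \<in> fspace A 3. coeffs_balanced f}"
    by (simp add: coeffs_balanced_def lookup_tc_scale tc.subspace_scale[OF subspace_fspace])
qed

lemma tcomp_2_fspace:
  "i \<in> {1, 2} \<Longrightarrow> f \<in> fspace A 2 \<Longrightarrow> g \<in> fspace A 2 \<Longrightarrow> tcomp i f g \<in> fspace A 3"
  using tcomp_fspace[of i 2 f A g 2] by auto

lemma lookup_S_S:
  "Poly_Mapping.lookup (tcomp i (S a) (S b) :: ('a, 'k::field) tree_comb) t =
    (\<Sum>c | (a, c) \<in> r. \<Sum>d | (b, d) \<in> r. if t = graft i (corolla c) (corolla d) then 1 else 0)"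
  unfolding S_def unfolding tcomp_sum_left unfolding tcomp_sum_right lookup_sum
  by (intro sum.cong refl) (auto simp: gen_def lookup_single when_def)

lemma lookup_S_S_same:
  assumes "i \<in> {1, 2}"
  shows "Poly_Mapping.lookup (tcomp i (S a) (S b) :: ('a, 'k::field) tree_comb) (graft i (corolla x) (corolla y)) =
    (if (a, x) \<in> r \<and> (b, y) \<in> r then 1 else 0)"
proof -
  have eq: "graft i (corolla x) (corolla y) = graft i (corolla c) (corolla d) \<longleftrightarrow> c = x \<and> d = y" for c d
    using assms by (auto simp: graft_corolla)
  have "Poly_Mapping.lookup (tcomp i (S a) (S b) :: ('a, 'k) tree_comb) (graft i (corolla x) (corolla y)) =
      (\<Sum>c | (a, c) \<in> r. if c = x then (\<Sum>d | (b, d) \<in> r. if d = y then 1 else 0) else 0)"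
    unfolding lookup_S_S eq by (intro sum.cong refl) auto
  then show ?thesis
    by (simp add: finite_r)
qed

lemma lookup_S_S_other:
  assumes "i \<in> {1, 2}" "j \<in> {1, 2}" "i \<noteq> j"
  shows "Poly_Mapping.lookup (tcomp i (S a) (S b)) (graft j (corolla x) (corolla y)) = 0"
  unfolding lookup_S_S using assms by (intro sum.neutral ballI) (auto simp: graft_corolla)

lemma lookup_S_diff:
  "Poly_Mapping.lookup (tcomp 1 (S m) (S m) - tcomp 2 (S m) (S m) :: ('a, 'k::field) tree_comb)
      (graft 1 (corolla x) (corolla y)) = (if (m, x) \<in> r \<and> (m, y) \<in> r then 1 else 0)"
  "Poly_Mapping.lookup (tcomp 1 (S m) (S m) - tcomp 2 (S m) (S m) :: ('a, 'k::field) tree_comb)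
      (graft 2 (corolla x) (corolla y)) = - (if (m, x) \<in> r \<and> (m, y) \<in> r then 1 else 0)"
  by (simp_all only: lookup_minus lookup_S_S_same lookup_S_S_other insert_iff simp_thms) simp_all

text \<open>This is why the coefficients of \<open>S m\<close> composed with itself depend on a
  comparable pair only through its minimum.\<close>

lemma below_poset_min:
  assumes "comparable r a b"
  shows "(m, a) \<in> r \<and> (m, b) \<in> r \<longleftrightarrow> (m, poset_min r a b) \<in> r"
  using assms trans_r by (auto simp: comparable_def poset_min_def)

lemma poset_min_mem: "a \<in> A \<Longrightarrow> b \<in> A \<Longrightarrow> poset_min R a b \<in> A"
  by (simp add: poset_min_def)

text \<open>No tree in the support carries comparable labels, so both sides of every condition are
  zero.\<close>

lemma S_S_balanced:
  assumes "i \<in> {1, 2}" "a \<in> A" "b \<in> A" "\<not> comparable r a b"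
  shows "tcomp i (S a) (S b) \<in> {f \<in> fspace A 3. coeffs_balanced f}"
proof -
  have zero: "Poly_Mapping.lookup (tcomp i (S a) (S b) :: ('a, 'b) tree_comb) (graft j (corolla x) (corolla y)) = 0"
    if "comparable r x y" "j \<in> {1, 2}" for j x y
  proof (cases "i = j")
    case True
    then show ?thesis
      using incomparable_up[OF assms(2-4), of x y] that assms(1) by (auto simp: lookup_S_S_same)
  qed (use that assms in \<open>simp add: lookup_S_S_other\<close>)
  have "comparable r (poset_min r x y) (poset_min r x y)" if "x \<in> A" "y \<in> A" for x y
    using poset_min_mem[OF that] refl_r by (auto simp: comparable_def)
  then show ?thesis
    unfolding coeffs_balanced_def mem_Collect_eq
    by (intro conjI ballI impI tcomp_2_fspace S_fspace assms) (subst zero zero; simp)+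
qed

lemma S_diff_balanced:
  assumes "m \<in> A"
  shows "tcomp 1 (S m) (S m) - tcomp 2 (S m) (S m) \<in> {f \<in> fspace A 3. coeffs_balanced f}"
proof -
  have "tcomp 1 (S m) (S m) - tcomp 2 (S m) (S m) \<in> fspace A 3"
    by (intro tc.subspace_diff[OF subspace_fspace] tcomp_2_fspace S_fspace assms) auto
  then show ?thesis
    unfolding coeffs_balanced_def mem_Collect_eq lookup_S_diff
    by (simp add: below_poset_min)
qed

text \<open>The difference of the two products pairs \<open>S c\<close>, \<open>c\<close> below
  \<open>a\<close>, with \<open>S d\<close>, \<open>d\<close> strictly above \<open>a\<close> in
  \<open>s\<close>; such \<open>c\<close> and \<open>d\<close> are distinct and comparable in
  \<open>s\<close>, hence incomparable in \<open>r\<close>.\<close>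

lemma rels_coeffs_balanced: "rels {f \<in> fspace A 3. coeffs_balanced (f :: ('a, 'k::field) tree_comb)}"
proof -
  let ?W = "{f \<in> fspace A 3. coeffs_balanced (f :: ('a, 'k) tree_comb)}"
  note W = subspace_coeffs_balanced[where 'b = 'k]
  have *: "\<beta> (B a) (B b) - \<beta> (B a) (B a) \<in> ?W"
    if \<beta>: "bil \<beta>" and SS: "\<And>c d. comparable s c d \<Longrightarrow> c \<noteq> d \<Longrightarrow> \<beta> (S c) (S d) \<in> ?W" and ab: "(a, b) \<in> s"
    for \<beta> and a b
  proof -
    have "\<beta> (B a) (B b - B a) \<in> ?W"
      unfolding B_diff[OF ab] unfolding B_def
    proof (rule bil_sum_mem[OF \<beta> W])
      fix c d assume "c \<in> {c. (c, a) \<in> s}" "d \<in> {c. (a, c) \<in> s \<and> c \<noteq> a \<and> (c, b) \<in> s}"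
      then have cd: "(c, a) \<in> s" "(a, d) \<in> s" "d \<noteq> a" by auto
      then have "(c, d) \<in> s" "c \<noteq> d"
        using trans_s[OF cd(1,2)] antisym_s[OF cd(2)] by auto
      then show "\<beta> (S c) (S d) \<in> ?W"
        by (intro SS) (auto simp: comparable_def)
    qed
    then show ?thesis by (simp add: bil_diff_right[OF \<beta>])
  qed
  have SS: "tcomp i (S c) (S d) \<in> ?W" if "i \<in> {1, 2}" "comparable s c d" "c \<noteq> d" for i c d
  proof (rule S_S_balanced[OF that(1)])
    show "c \<in> A" "d \<in> A"
      using that(2) s_sub by (auto simp: comparable_def)
  qed (rule comparable_s_incomparable_r[OF that(2,3)])
  have 1: "tcomp i (B a) (B b) - tcomp i (B a) (B a) \<in> ?W" if "i \<in> {1, 2}" "(a, b) \<in> s" for i a b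
    by (rule *[OF bil_tcomp SS[OF that(1)] that(2)])
  have 2: "tcomp i (B b) (B a) - tcomp i (B a) (B a) \<in> ?W" if "i \<in> {1, 2}" "(a, b) \<in> s" for i a b
    by (rule *[OF bil_tcomp_flip SS[OF that(1)] that(2)]) (auto simp: comparable_def)
  have 3: "tcomp 1 (B a) (B a) - tcomp 2 (B a) (B a) \<in> ?W" if "a \<in> A" for a
    unfolding B_def
  proof (rule bil_sum_mem[OF bil_tcomp_diff W])
    fix c d assume cd: "c \<in> {c. (c, a) \<in> s}" "d \<in> {c. (c, a) \<in> s}"
    show "tcomp 1 (S c) (S d) - tcomp 2 (S c) (S d) \<in> ?W"
    proof (cases "c = d")
      case True
      moreover have "c \<in> A" using cd s_sub by auto
      ultimately show ?thesis by (simp only: S_diff_balanced)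
    next
      case False
      then have "comparable s c d" using forest_s cd by blast
      then show ?thesis
        by (intro tc.subspace_diff[OF W] SS) (use False in auto)
    qed
  qed
  show ?thesis
    unfolding rels_def by (intro conjI ballI allI impI 1 2 3)
qed

text \<open>Subtracting a suitable combination \<open>h\<close> of the
  \<open>S m \<circ>\<^sub>1 S m - S m \<circ>\<^sub>2 S m\<close> kills all coefficients of
  \<open>f\<close> at comparable labels; the trees that remain lie in \<open>V\<close> by
  \<open>rels_gen_gen\<close>.\<close>

lemma coeffs_balanced_mem:
  fixes V :: "('a, 'k::field) tree_comb set"
  assumes V: "tc.subspace V" and rels: "rels V" and f: "f \<in> fspace A 3" "coeffs_balanced f"
  shows "f \<in> V"
proof -
  \<comment> \<open>The coefficients of \<open>h\<close> are the Moebius inverse of the diagonal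
    coefficients of \<open>f\<close>.\<close>
  obtain g where g: "\<And>n. n \<in> A \<Longrightarrow>
      (\<Sum>m | (m, n) \<in> r. g m) = Poly_Mapping.lookup f (graft 1 (corolla n) (corolla n))"
    by (rule zeta_surj[OF finite_A order_r,
          where v = "\<lambda>n. Poly_Mapping.lookup f (graft 1 (corolla n) (corolla n))"]) blast
  define h where "h = (\<Sum>m\<in>A. tc_scale (g m) (tcomp 1 (S m) (S m) - tcomp 2 (S m) (S m)))"
  have hV: "h \<in> V"
    unfolding h_def by (intro tc.subspace_sum[OF V] tc.subspace_scale[OF V] rels_S_diff[OF V rels])
  have h3: "h \<in> fspace A 3"
    unfolding h_def
    by (intro tc.subspace_sum[OF subspace_fspace] tc.subspace_scale[OF subspace_fspace]
        CollectD[OF S_diff_balanced, THEN conjunct1])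
  have sum_g: "(\<Sum>m\<in>A. g m * (if (m, a) \<in> r \<and> (m, b) \<in> r then 1 else 0)) =
      Poly_Mapping.lookup f (graft 1 (corolla (poset_min r a b)) (corolla (poset_min r a b)))"
    if "a \<in> A" "b \<in> A" "comparable r a b" for a b
  proof -
    have "(\<Sum>m\<in>A. g m * (if (m, a) \<in> r \<and> (m, b) \<in> r then 1 else 0)) =
        (\<Sum>m\<in>{m \<in> A. (m, poset_min r a b) \<in> r}. g m)"
      unfolding below_poset_min[OF that(3)] sum.inter_filter[OF finite_A] by (intro sum.cong refl) auto
    also have "{m \<in> A. (m, poset_min r a b) \<in> r} = {m. (m, poset_min r a b) \<in> r}"
      using r_sub by auto
    finally show ?thesis using g poset_min_mem that by simp
  qed
  let ?d = "f - h"
  have d0: "Poly_Mapping.lookup ?d (graft 1 (corolla a) (corolla b)) = 0"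
    "Poly_Mapping.lookup ?d (graft 2 (corolla a) (corolla b)) = 0"
    if ab: "a \<in> A" "b \<in> A" "comparable r a b" for a b
  proof -
    let ?m = "poset_min r a b"
    have m: "?m \<in> A" "comparable r ?m ?m" "poset_min r ?m ?m = ?m"
      using poset_min_mem[OF ab(1,2)] refl_r by (auto simp: comparable_def poset_min_def[of r ?m])
    have "Poly_Mapping.lookup h (graft 1 (corolla a) (corolla b)) =
        Poly_Mapping.lookup f (graft 1 (corolla ?m) (corolla ?m))"
      unfolding h_def lookup_sum lookup_tc_scale lookup_S_diff by (rule sum_g[OF ab])
    moreover have "Poly_Mapping.lookup h (graft 2 (corolla a) (corolla b)) =
        - Poly_Mapping.lookup f (graft 1 (corolla ?m) (corolla ?m))"
      unfolding h_def lookup_sum lookup_tc_scale lookup_S_diff mult_minus_right sum_negf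
      by (subst sum_g[OF ab]) (rule refl)
    moreover have "Poly_Mapping.lookup f (graft 1 (corolla a) (corolla b)) =
        - Poly_Mapping.lookup f (graft 2 (corolla ?m) (corolla ?m))"
      "Poly_Mapping.lookup f (graft 2 (corolla a) (corolla b)) =
        - Poly_Mapping.lookup f (graft 1 (corolla ?m) (corolla ?m))"
      using f(2)[unfolded coeffs_balanced_def, rule_format, OF ab] by simp_all
    \<comment> \<open>The condition at the pair of \<open>?m\<close> with itself, which is its own
      minimum, links the two kinds of diagonal coefficients.\<close>
    moreover have "Poly_Mapping.lookup f (graft 1 (corolla ?m) (corolla ?m)) =
        - Poly_Mapping.lookup f (graft 2 (corolla ?m) (corolla ?m))"
      using f(2)[unfolded coeffs_balanced_def, rule_format, OF m(1,1,2)] unfolding m(3) by blast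
    ultimately show "Poly_Mapping.lookup ?d (graft 1 (corolla a) (corolla b)) = 0"
      "Poly_Mapping.lookup ?d (graft 2 (corolla a) (corolla b)) = 0"
      by (simp_all only: lookup_minus, simp_all)
  qed
  have "Poly_Mapping.single t (Poly_Mapping.lookup ?d t) \<in> V" if t: "t \<in> Poly_Mapping.keys ?d" for t
  proof -
    have d3: "?d \<in> fspace A 3"
      by (rule tc.subspace_diff[OF subspace_fspace f(1) h3])
    then have size: "size1 t = 3" and sub: "set_tree t \<subseteq> A"
      using t by (auto simp: fspace_iff)
    have nz: "Poly_Mapping.lookup ?d t \<noteq> 0"
      using t by (simp add: in_keys_iff)
    obtain i a b where i: "i \<in> {1, 2 :: nat}" and ti: "t = graft i (corolla a) (corolla b)"
      by (rule size1_eq_3[OF size]) auto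
    then have ab: "a \<in> A" "b \<in> A"
      using sub by (auto simp: graft_corolla)
    then have "\<not> comparable r a b"
      using d0[OF ab] nz i ti by auto
    then have "tc_scale (Poly_Mapping.lookup ?d t) (tcomp i (gen a) (gen b)) \<in> V"
      by (intro tc.subspace_scale[OF V] rels_gen_gen[OF V rels i ab])
    then show ?thesis by (simp add: gen_def ti)
  qed
  then have "?d \<in> V"
    by (subst tc_eq_sum[of ?d]) (rule tc.subspace_sum[OF V])
  from tc.subspace_add[OF V this hV] show ?thesis by simp
qed

text \<open>The relators mix compositions at inputs 1 and 2, while \<open>rels\<close> compares
  within one input and links the two only on the diagonal; adding or subtracting the diagonal
  relation passes from one form to the other.\<close>

lemma rels_iff_relators:
  assumes V: "tc.subspace V"
  shows "rels V \<longleftrightarrow> lift B ` As_relators A s \<subseteq> (V :: ('a, 'k::field) tree_comb set)"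
proof -
  have lift: "lift B (gen_comp a i b) = tcomp i (B a) (B b :: ('a, 'k) tree_comb)"
    if "i \<in> {1, 2}" "a \<in> A" "b \<in> A" for a b i
    using that lift_tcomp[where h = B, OF B_fspace _ _ gen_fspace[OF that(2)] gen_fspace[OF that(3)], of i]
    by (auto simp: gen_comp_tcomp lift_gen[where h = B, OF B_fspace])
  let ?R = "\<lambda>a b. tcomp 1 (B a) (B b) - tcomp 2 (B (poset_min s a b)) (B (poset_min s a b)) :: ('a, 'k) tree_comb"
  let ?L = "\<lambda>a b. tcomp 1 (B (poset_min s a b)) (B (poset_min s a b)) - tcomp 2 (B a) (B b) :: ('a, 'k) tree_comb"
  have img: "lift B ` As_relators A s = {?R a b | a b. a \<in> A \<and> b \<in> A \<and> comparable s a b} \<union>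
      {?L a b | a b. a \<in> A \<and> b \<in> A \<and> comparable s a b}"
    unfolding As_relators_def image_Un
    by (rule arg_cong2[where f = "(\<union>)"])
      (force simp: image_iff tcl.linear_diff[OF linear_lin] lift poset_min_mem)+
  have "lift B ` As_relators A s \<subseteq> V \<longleftrightarrow>
      (\<forall>a\<in>A. \<forall>b\<in>A. comparable s a b \<longrightarrow> ?R a b \<in> V \<and> ?L a b \<in> V)"
    unfolding img Un_subset_iff by blast
  also have "\<dots> \<longleftrightarrow> rels V"
  proof
    assume H: "\<forall>a\<in>A. \<forall>b\<in>A. comparable s a b \<longrightarrow> ?R a b \<in> V \<and> ?L a b \<in> V"
    have min: "poset_min s a b = a" "poset_min s b a = a" if "(a, b) \<in> s" for a b
      using that antisym_s by (auto simp: poset_min_def)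
    have diag: "tcomp 1 (B a) (B a) - tcomp 2 (B a) (B a) \<in> V" if "a \<in> A" for a
      using H[rule_format, of a a] min[OF refl_s[OF that]] that refl_s by (simp add: comparable_def)
    have "tcomp i (B c) (B d) - tcomp i (B a) (B a) \<in> V"
      if "(a, b) \<in> s" "i \<in> {1, 2}" "(c, d) = (a, b) \<or> (c, d) = (b, a)" for i a b c d
    proof -
      have A: "a \<in> A" "c \<in> A" "d \<in> A" "comparable s c d" "poset_min s c d = a"
        using that s_sub min[OF that(1)] by (auto simp: comparable_def)
      then have RL: "tcomp 1 (B c) (B d) - tcomp 2 (B a) (B a) \<in> V" "tcomp 1 (B a) (B a) - tcomp 2 (B c) (B d) \<in> V"
        using H by metis+
      show ?thesis
      proof (cases "i = 1")
        case True
        then show ?thesis using tc.subspace_diff[OF V RL(1) diag[OF A(1)]] by simp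
      next
        case False
        then show ?thesis using that(2) tc.subspace_diff[OF V diag[OF A(1)] RL(2)] by simp
      qed
    qed
    then show "rels V"
      unfolding rels_def using diag by blast
  next
    assume H: "rels V"
    show "\<forall>a\<in>A. \<forall>b\<in>A. comparable s a b \<longrightarrow> ?R a b \<in> V \<and> ?L a b \<in> V"
    proof (intro ballI impI)
      fix c d assume cd: "c \<in> A" "d \<in> A" "comparable s c d"
      let ?a = "poset_min s c d"
      have a: "?a \<in> A" using cd poset_min_mem by blast
      have *: "tcomp i (B c) (B d) - tcomp i (B ?a) (B ?a) \<in> V" if "i \<in> {1, 2}" for i
        using H that cd(3) unfolding rels_def by (auto simp: poset_min_def comparable_def)
      have diag: "tcomp 1 (B ?a) (B ?a) - tcomp 2 (B ?a) (B ?a) \<in> V"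
        using H a unfolding rels_def by blast
      show "?R c d \<in> V \<and> ?L c d \<in> V"
        using tc.subspace_add[OF V *[of 1] diag] tc.subspace_diff[OF V diag *[of 2]] by simp
    qed
  qed
  finally show ?thesis by blast
qed

text \<open>The annihilator satisfies \<open>rels\<close>, so it contains the images of the
  relators; their span satisfies \<open>rels\<close>, so it contains the annihilator.\<close>

lemma lift_B_relations:
  "lift B ` snd (As_presentation A s) = snd (koszul_dual (As_presentation A r) :: ('a, 'k::field) presentation)"
proof -
  let ?W = "{f \<in> fspace A 3. coeffs_balanced (f :: ('a, 'k) tree_comb)}"
  let ?V = "tc.span (lift B ` As_relators A s) :: ('a, 'k) tree_comb set"
  have "lift B ` snd (As_presentation A s) = ?V"
    by (simp add: As_presentation_def tcl.linear_span_image[OF linear_lin])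
  also have "?V = ?W"
  proof
    show "?V \<subseteq> ?W"
      using rels_iff_relators[OF subspace_coeffs_balanced] rels_coeffs_balanced
      by (intro tc.span_minimal subspace_coeffs_balanced) blast
    have "rels ?V"
      unfolding rels_iff_relators[OF tc.subspace_span] by (rule tc.span_superset)
    then show "?W \<subseteq> ?V"
      using coeffs_balanced_mem[OF tc.subspace_span] by blast
  qed
  finally show ?thesis
    by (simp add: koszul_dual_As)
qed

end

section \<open>Descent to the presented operads\<close>

theorem theorem4p4:
  fixes A :: "'a set" and r :: "'a rel" and lab :: "'a \<Rightarrow> nat"
    and P D :: "('a, 'k::field_char_0) presentation"
  assumes "thin_forest_poset A r"
    and "standard_labeling A r lab"
  defines "P \<equiv> As_presentation A (dual_order A r lab)"
    and "D \<equiv> koszul_dual (As_presentation A r)"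
  shows "\<exists>\<phi>. operad_iso (presented_operad P) (presented_operad D) \<phi> \<and>
           (\<forall>b \<in> A. \<phi> 2 (pres_class P 2 (gen b)) = pres_class D 2 (Abar A r lab b)) \<and>
           (\<forall>\<psi>. operad_hom (presented_operad P) (presented_operad D) \<psi> \<and>
                (\<forall>b \<in> A. \<psi> 2 (pres_class P 2 (gen b)) = pres_class D 2 (Abar A r lab b)) \<longrightarrow>
                (\<forall>n. \<forall>x \<in> opd_space (presented_operad P) n. \<psi> n x = \<phi> n x))"
proof -
  note dual = dual_order_poset[OF assms(1,2)]
  have po: "finite A" "partial_order_on A r"
    and forest: "\<And>a b c. (a, c) \<in> r \<Longrightarrow> (b, c) \<in> r \<Longrightarrow> comparable r a b"
    using assms(1) unfolding thin_forest_poset_def forest_poset_def comparable_def by blast+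
  interpret dual_forests A r "dual_order A r lab"
    by unfold_locales (use po dual forest in blast)+
  have Abar: "Abar A r lab b = (B b :: ('a, 'k) tree_comb)" for b
    by (simp add: Abar_def B_def S_def)
  let ?F = "free_operad A :: ('k, ('a, 'k) tree_comb) ns_operad"
  let ?\<Phi> = "lift B :: ('a, 'k) tree_comb \<Rightarrow> ('a, 'k) tree_comb"
  have fst: "fst P = A" "fst D = A"
    by (simp_all add: P_def D_def As_presentation_def koszul_dual_def)
  have snd: "?\<Phi> ` snd P = snd D"
    unfolding P_def D_def by (rule lift_B_relations)
  have snd_D: "snd D \<subseteq> fspace A 3"
    unfolding D_def koszul_dual_As by blast
  have snd_P: "snd P \<subseteq> fspace A 3"
  proof -
    have "As_relators A (dual_order A r lab) \<subseteq> (fspace A 3 :: ('a, 'k) tree_comb set)"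
      unfolding As_relators_def gen_comp_tcomp
      by (auto intro!: tc.subspace_diff[OF subspace_fspace] tcomp_2_fspace gen_fspace poset_min_mem)
    then show ?thesis
      unfolding P_def As_presentation_def by (simp add: tc.span_minimal[OF _ subspace_fspace])
  qed
  let ?R = "\<lambda>p :: ('a, 'k) presentation. \<lambda>n :: nat. if n = 3 then snd p else {}"
  have R: "?R P n \<subseteq> fspace A n" "?R D n \<subseteq> fspace A n" for n
    using snd_P snd_D by auto
  define I where "I = relation_ideal P"
  define J where "J = relation_ideal D"
  have I: "operad_ideal ?F I" and J: "operad_ideal ?F J"
    unfolding I_def J_def relation_ideal_def fst
    by (rule operad_ideal_generated(1)[OF operad_closed_free R(1)],
        rule operad_ideal_generated(1)[OF operad_closed_free R(2)])
  have "?\<Phi> ` I n = J n" for n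
  proof -
    have "(\<lambda>n. ?\<Phi> ` ?R P n) = ?R D"
      using snd by (simp add: fun_eq_iff)
    then show ?thesis
      unfolding I_def J_def relation_ideal_def fst
      using generated_ideal_image[OF operad_closed_free operad_iso_lift_B _ R(1), of n]
      by (simp add: tcl.linear_0[OF linear_lin])
  qed
  then have IJ: "(\<lambda>n. ?\<Phi> ` I n) = J" by (simp add: fun_eq_iff)
  have I_sub: "I n \<subseteq> fspace A n" for n
    using I by (simp add: operad_ideal_def)
  have P: "presented_operad P = quotient_operad ?F I" and D: "presented_operad D = quotient_operad ?F J"
    by (simp_all add: presented_operad_def fst I_def J_def)
  have cP: "pres_class P = opd_coset ?F I" and cD: "pres_class D = opd_coset ?F J"
    by (simp_all add: fun_eq_iff pres_class_def fst I_def J_def)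
  \<comment> \<open>The lift carries one relation ideal onto the other, so the induced map on a
    coset is simply its direct image.\<close>
  let ?\<phi> = "\<lambda>n. (`) ?\<Phi>" 
  have iso: "operad_iso (presented_operad P) (presented_operad D) ?\<phi>"
    using operad_iso_quotient(1)[OF operad_closed_free operad_iso_lift_B I_sub] unfolding P D IJ .
  have gens: "?\<phi> 2 (pres_class P 2 (gen b)) = pres_class D 2 (Abar A r lab b)" if "b \<in> A" for b
    using operad_iso_quotient(2)[OF operad_closed_free operad_iso_lift_B I_sub gen_fspace[OF that]]
    unfolding cP cD IJ Abar lift_gen[where h = B, OF B_fspace[OF that]] .
  show ?thesis
  proof (intro exI[where x = ?\<phi>] conjI allI impI ballI)
    fix \<psi> :: "nat \<Rightarrow> ('a, 'k) tree_comb set \<Rightarrow> ('a, 'k) tree_comb set" and n x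
    assume \<psi>: "operad_hom (presented_operad P) (presented_operad D) \<psi> \<and>
        (\<forall>b \<in> A. \<psi> 2 (pres_class P 2 (gen b)) = pres_class D 2 (Abar A r lab b))"
      and x: "x \<in> opd_space (presented_operad P) n"
    show "\<psi> n x = ?\<phi> n x"
    proof (rule quotient_free_hom_unique[where \<phi> = \<psi> and \<psi> = ?\<phi> and n = n, OF I J])
      show "operad_hom (quotient_operad ?F I) (quotient_operad ?F J) \<psi>"
        using \<psi> unfolding P D by blast
      show "operad_hom (quotient_operad ?F I) (quotient_operad ?F J) ?\<phi>"
        using iso unfolding P D operad_iso_def by blast
      show "\<psi> 2 (opd_coset ?F I 2 (gen a)) = ?\<phi> 2 (opd_coset ?F I 2 (gen a))" if "a \<in> A" for a
        using \<psi> gens that unfolding cP cD by simp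
    qed (use x in \<open>simp add: P\<close>)
  qed (simp_all only: iso gens)
qed

end
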